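(* Let $\mathcal{T}$ be a singular triangulation of a connected, closed, oriented 3-dimensional pseudo-manifold $P$, with set of tetrahedra $T$, set of edges $E$, set of vertices $V$, and with $g_v$ the genus of the link of $v\in V$. Let $G\colon \mathbb{H}^T\to\mathbb{C}^E$ be the log-curvature map. Then for all $u\in\mathbb{C}^E$, the complex variety $G^{-1}(u)$ is either empty or a smooth complex manifold of (complex) dimension $\sum_{v\in V} g_v$.
   Context: Triangulation. Let $\widetilde{\Delta}$ be a finite disjoint union of oriented Euclidean 3-simplices and $\Phi$ a family of orientation-reversing affine isomorphisms pairing the 2-dimensional faces of $\widetilde\Delta$, closed under inverses and such that every face is the domain of a unique element of $\Phi$. The quotient $P=\widetilde\Delta/\Phi$, assumed connected, is a closed orientable 3-dimensional pseudo-manifold with quotient map $p\colon\widetilde\Delta\to P$, and $\mathcal{T}=(\widetilde\Delta,\Phi,p)$ is a (singular) triangulation of $P$. $T$ is the set of 3-simplices of $\widetilde\Delta$; $E$ and $V$ are the sets of edges and vertices of $P$, i.e. the equivalence classes of 1- and 0-simplices of $\widetilde\Delta$. For $v\in V$, $\mathrm{Lk}(v)$ denotes the vertex link, a closed orientable surface of genus $g_v\ge 0$. Quadrilateral types. A quadrilateral type $q$ in a 3-simplex $\sigma$ is a pair $q=\{e_0,e_1\}$ of opposite edges of $\sigma$ (we write $q<\sigma$); each $\sigma$ has three. The orientation of $\sigma$ gives a cyclic order $q\to q'\to q''\to q$ on them: if the vertices of $\sigma$ are labelled $0,1,2,3$ compatibly with the orientation, it is (type containing edge $01$) $\to$ (type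 containing $02$) $\to$ (type containing $03$) $\to$ (type containing $01$). $\Box$ is the set of all quadrilateral types of all $\sigma\in T$. For $q\in\Box$, $e\in E$, $i(q,e)\in\{0,1,2\}$ is the number of the two edges in $q$ that are mapped by $p$ to $e$. Log-curvature map. Let $\mathbb{H}\subset\mathbb{C}$ be the open upper half plane and $Z=\{z\in\mathbb{H}^{\Box} : z(q')=\tfrac{1}{1-z(q)}\ \text{for all } q\in\Box\}$. Fixing a preferred quadrilateral type $q_\sigma<\sigma$ for each $\sigma\in T$, $Z$ is identified with $\mathbb{H}^T$ via $z\mapsto (z(q_\sigma))_{\sigma\in T}$. The log-curvature map $G\colon Z=\mathbb{H}^T\to\mathbb{C}^E$ is $G(z)(e)=\sum_{q\in\Box} i(q,e)\log z(q)$, where $\log$ is the standard branch on $\mathbb{C}\setminus(-\infty,0]$. *)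

theory Defs
  imports "HOL-Analysis.Analysis"
begin

section \<open>Triangulations\<close>

text \<open>
  The 3-simplices are the elements of a finite type \<open>'t\<close>. The vertices of each of them are
  labelled by the four elements \<open>0, 1, 2, 3\<close> of type \<open>4\<close>, compatibly with its orientation. A
  face of the disjoint union (a simplex of dimension \<open>card A - 1\<close>) is a pair \<open>(s, A)\<close> of a
  3-simplex \<open>s\<close> and a nonempty set \<open>A\<close> of its vertices.

  An affine isomorphism between two triangles is determined by what it does to the vertices.
  \<open>\<Phi> s f = (t, \<pi>)\<close> says that the triangle of \<open>s\<close> opposite to the vertex \<open>f\<close> is glued to the
  triangle of \<open>t\<close> opposite to \<open>\<pi> f\<close>, where each vertex \<open>i \<noteq> f\<close> goes to \<open>\<pi> i\<close>. The value
  \<open>\<pi> f\<close> is thus only used to extend the map of the triangles to a bijection of all vertices,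
  that is, to an affine isomorphism from \<open>s\<close> to \<open>t\<close>. As it takes the inner side of one triangle
  to the inner side of the other, this extension reverses orientation (\<open>\<pi>\<close> is odd) iff the map
  of the triangles reverses the orientations induced on them as boundary faces.
\<close>

type_synonym 't gluing = "'t \<Rightarrow> 4 \<Rightarrow> 't \<times> (4 \<Rightarrow> 4)"
type_synonym 't subsimplex = "'t \<times> 4 set"

definition face_pairing :: "'t gluing \<Rightarrow> bool" where
  "face_pairing \<Phi> \<longleftrightarrow>
     (\<forall>s f t \<pi>. \<Phi> s f = (t, \<pi>) \<longrightarrow>
        bij \<pi> \<and> \<not> evenperm \<pi> \<and> (t, \<pi> f) \<noteq> (s, f) \<and> \<Phi> t (\<pi> f) = (s, inv \<pi>))"

text \<open>
  The quotient space is connected iff any two 3-simplices are joined by a chain of 3-simplices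
  in which successive ones are glued along a triangle.
\<close>

definition connected_gluing :: "'t gluing \<Rightarrow> bool" where
  "connected_gluing \<Phi> \<longleftrightarrow> {(s, fst (\<Phi> s f)) |s f. True}\<^sup>* = UNIV"

definition oriented_triangulation :: "'t gluing \<Rightarrow> bool" where
  "oriented_triangulation \<Phi> \<longleftrightarrow> face_pairing \<Phi> \<and> connected_gluing \<Phi>"

text \<open>
  For a face pairing the following relation is symmetric, so that its reflexive transitive
  closure is the equivalence relation which it generates.
\<close>

definition glued :: "'t gluing \<Rightarrow> ('t subsimplex \<times> 't subsimplex) set" where
  "glued \<Phi> = {((s, A), (t, \<pi> ` A)) |s A f t \<pi>. f \<notin> A \<and> \<Phi> s f = (t, \<pi>)}"

definition vertices :: "'t gluing \<Rightarrow> 't subsimplex set set" where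
  "vertices \<Phi> = {(s, A). card A = 1} // (glued \<Phi>)\<^sup>*"

definition edges :: "'t gluing \<Rightarrow> 't subsimplex set set" where
  "edges \<Phi> = {(s, A). card A = 2} // (glued \<Phi>)\<^sup>*"

section \<open>Vertex links\<close>

text \<open>
  The link of a vertex is tiled by one small triangle for each corner \<open>(s, {i})\<close> in its class.
  The cells of this triangle are where it meets the faces \<open>(s, B)\<close> with \<open>i \<in> B\<close>, and such a
  cell \<open>(s, i, B)\<close> has dimension \<open>card B - 2\<close>. The face pairings restrict to gluings of these
  cells. In particular an edge with both ends at the vertex gives two points of the link.
\<close>

definition link_glued :: "'t gluing \<Rightarrow> (('t \<times> 4 \<times> 4 set) \<times> ('t \<times> 4 \<times> 4 set)) set" where
  "link_glued \<Phi> =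
     {((s, i, B), (t, \<pi> i, \<pi> ` B)) |s i B f t \<pi>. i \<in> B \<and> f \<notin> B \<and> \<Phi> s f = (t, \<pi>)}"

definition link_cells :: "'t gluing \<Rightarrow> 't subsimplex set \<Rightarrow> nat \<Rightarrow> ('t \<times> 4 \<times> 4 set) set set" where
  "link_cells \<Phi> v k =
     {(s, i, B). (s, {i}) \<in> v \<and> i \<in> B \<and> card B = k + 2} // (link_glued \<Phi>)\<^sup>*"

definition link_euler_char :: "'t gluing \<Rightarrow> 't subsimplex set \<Rightarrow> int" where
  "link_euler_char \<Phi> v = (\<Sum>k\<le>2. (-1) ^ k * int (card (link_cells \<Phi> v k)))"

text \<open>
  The genus \<open>g\<close> of a closed orientable surface is given by \<open>\<chi> = 2 - 2 * g\<close>. It is taken as a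
  rational number here so that nothing is truncated.
\<close>

definition link_genus :: "'t gluing \<Rightarrow> 't subsimplex set \<Rightarrow> rat" where
  "link_genus \<Phi> v = (2 - of_int (link_euler_char \<Phi> v)) / 2"

section \<open>Quadrilateral types and the log-curvature map\<close>

text \<open>\<open>(s, Q01)\<close> is the quadrilateral type in \<open>s\<close> which contains the edge \<open>{0, 1}\<close>, and so on.\<close>

datatype quad = Q01 | Q02 | Q03

fun quad_edges :: "quad \<Rightarrow> 4 set set" where
  "quad_edges Q01 = {{0, 1}, {2, 3}}"
| "quad_edges Q02 = {{0, 2}, {1, 3}}"
| "quad_edges Q03 = {{0, 3}, {1, 2}}"

fun next_quad :: "quad \<Rightarrow> quad" where
  "next_quad Q01 = Q02"
| "next_quad Q02 = Q03"
| "next_quad Q03 = Q01"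

instance quad :: finite
proof
  have "(UNIV :: quad set) = {Q01, Q02, Q03}"
    using quad.exhaust by auto
  then show "finite (UNIV :: quad set)"
    by (metis finite.emptyI finite.insertI)
qed

definition incidence :: "'t \<times> quad \<Rightarrow> 't subsimplex set \<Rightarrow> nat" where
  "incidence = (\<lambda>(s, q) e. card {A \<in> quad_edges q. (s, A) \<in> e})"

definition shapes :: "('t \<times> quad \<Rightarrow> complex) set" where
  "shapes = {z. (\<forall>q. Im (z q) > 0) \<and> (\<forall>s q. z (s, next_quad q) = 1 / (1 - z (s, q)))}"

definition upper_half_space :: "(complex ^ 't) set" where
  "upper_half_space = {w. \<forall>s. Im (w $ s) > 0}"

text \<open>The coordinates on \<open>shapes\<close> given by a preferred quadrilateral type in each 3-simplex.\<close>

definition shape_coords :: "('t \<Rightarrow> quad) \<Rightarrow> ('t \<times> quad \<Rightarrow> complex) \<Rightarrow> complex ^ 't" where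
  "shape_coords pref z = (\<chi> s. z (s, pref s))"

lemma bij_betw_shape_coords:
  fixes pref :: "'t::finite \<Rightarrow> quad"
  shows "bij_betw (shape_coords pref) shapes upper_half_space"
proof (rule bij_betw_imageI)
  show "inj_on (shape_coords pref) shapes"
  proof (rule inj_onI, rule ext)
    fix z z' :: "'t \<times> quad \<Rightarrow> complex" and x :: "'t \<times> quad"
    assume z: "z \<in> shapes" "z' \<in> shapes" and eq: "shape_coords pref z = shape_coords pref z'"
    obtain s q where x: "x = (s, q)" by (cases x)
    have a: "z (s, next_quad r) = 1 / (1 - z (s, r))" "z' (s, next_quad r) = 1 / (1 - z' (s, r))"
      for r using z by (auto simp: shapes_def)
    have b: "z (s, pref s) = z' (s, pref s)"
      using arg_cong[OF eq, of "\<lambda>w. w $ s"] by (simp add: shape_coords_def)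
    have c: "z (s, next_quad (pref s)) = z' (s, next_quad (pref s))"
      by (simp only: a b)
    have d: "z (s, next_quad (next_quad (pref s))) = z' (s, next_quad (next_quad (pref s)))"
      by (simp only: a(1)[of "next_quad (pref s)"] a(2)[of "next_quad (pref s)"] c)
    have "q \<in> {pref s, next_quad (pref s), next_quad (next_quad (pref s))}"
      by (cases q; cases "pref s") auto
    with b c d x show "z x = z' x" by auto
  qed
  show "shape_coords pref ` shapes = upper_half_space"
  proof (intro equalityI subsetI)
    fix w :: "complex ^ 't" assume w: "w \<in> upper_half_space"
    define z where "z = (\<lambda>(s, q). if q = pref s then w $ s
      else if q = next_quad (pref s) then 1 / (1 - w $ s) else 1 - 1 / w $ s)"
    have im: "Im (w $ s) > 0" for s using w by (simp add: upper_half_space_def)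
    have nz: "w $ s \<noteq> 0" "1 - w $ s \<noteq> 0" for s
      using im[of s] by (auto simp: complex_eq_iff)
    have "Im (z (s, q)) > 0" for s q
    proof -
      have "Im (1 / (1 - w $ s)) > 0" "Im (1 - 1 / w $ s) > 0"
        using im[of s] nz[of s]
        by (auto simp: Im_divide complex_eq_iff intro!: divide_pos_pos sum_power2_gt_zero_iff[THEN iffD2])
      then show ?thesis using im[of s] by (auto simp: z_def)
    qed
    moreover have "z (s, next_quad q) = 1 / (1 - z (s, q))" for s q
      using nz[of s] by (cases q; cases "pref s") (auto simp: z_def divide_simps)
    ultimately have "z \<in> shapes" by (auto simp: shapes_def)
    moreover have "shape_coords pref z = w"
      by (simp add: shape_coords_def z_def vec_eq_iff)
    ultimately show "w \<in> shape_coords pref ` shapes" by blast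
  qed (auto simp: shapes_def upper_half_space_def shape_coords_def)
qed

text \<open>The complex logarithm \<open>Ln\<close> is the principal branch.\<close>

definition log_curvature ::
    "('t::finite \<Rightarrow> quad) \<Rightarrow> complex ^ 't \<Rightarrow> 't subsimplex set \<Rightarrow> complex" where
  "log_curvature pref w e =
     (let z = the_inv_into shapes (shape_coords pref) w
      in \<Sum>q\<in>UNIV. of_nat (incidence q e) * Ln (z q))"

text \<open>Only the values of \<open>u\<close> on the edges of the triangulation matter.\<close>

definition log_curvature_fibre ::
    "'t::finite gluing \<Rightarrow> ('t \<Rightarrow> quad) \<Rightarrow> ('t subsimplex set \<Rightarrow> complex) \<Rightarrow> (complex ^ 't) set" where
  "log_curvature_fibre \<Phi> pref u =
     {w \<in> upper_half_space. \<forall>e\<in>edges \<Phi>. log_curvature pref w e = u e}"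

section \<open>Complex submanifolds\<close>

definition holomorphic_map_on ::
    "(complex ^ 'm \<Rightarrow> complex ^ 'n) \<Rightarrow> (complex ^ 'm) set \<Rightarrow> bool" where
  "holomorphic_map_on f U \<longleftrightarrow>
     (\<forall>x\<in>U. \<exists>f'. (f has_derivative f') (at x) \<and> (\<forall>c v. f' (c *s v) = c *s f' v))"

text \<open>
  \<open>M\<close> is an embedded complex submanifold of dimension \<open>d\<close> if every point of \<open>M\<close> has an open
  neighbourhood \<open>U\<close> and a biholomorphic map from \<open>U\<close> onto an open set \<open>W\<close> that takes \<open>M \<inter> U\<close> to
  the part of \<open>W\<close> in a \<open>d\<close>-dimensional coordinate subspace.
\<close>

definition complex_submanifold :: "nat \<Rightarrow> (complex ^ 'n) set \<Rightarrow> bool" where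
  "complex_submanifold d M \<longleftrightarrow>
     (\<forall>x\<in>M. \<exists>U (W :: (complex ^ 'n) set) \<phi> \<psi> S.
        open U \<and> x \<in> U \<and> open W \<and>
        holomorphic_map_on \<phi> U \<and> holomorphic_map_on \<psi> W \<and>
        \<phi> ` U = W \<and> \<psi> ` W = U \<and> (\<forall>y\<in>U. \<psi> (\<phi> y) = y) \<and> (\<forall>w\<in>W. \<phi> (\<psi> w) = w) \<and>
        card S = d \<and> \<phi> ` (M \<inter> U) = {w \<in> W. \<forall>i. i \<notin> S \<longrightarrow> w $ i = 0})"

end

theory Submission
  imports Defs
begin

text \<open>
  The complex dimension asked for is \<open>V - E + T\<close>, by counting the cells of all vertex links: they
  have \<open>2 E\<close> vertices in total, because an oriented triangulation does not glue an edge to its own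
  reverse. So it suffices that the derivative of \<open>G\<close> has rank \<open>E - V\<close> everywhere, and that near
  each point \<open>E - V\<close> of the components of \<open>G\<close> determine the others.

  Let \<open>y\<close> be a vector of edge weights which annihilates the derivative, and let \<open>Y q\<close> be the sum
  of \<open>y\<close> over the two edges in \<open>q\<close>. Then \<open>Y q'' - Y q = z (Y q' - Y q)\<close> in each 3-simplex. By the
  symplectic relation of Neumann and Zagier, the sum over all 3-simplices of the signed areas of the
  triangles \<open>(Y q, Y q', Y q'')\<close> vanishes. As each of them is \<open>Im z / 2\<close> times a square, the
  triangles degenerate to points, and this forces \<open>y\<close> to be of the form
  \<open>y e = x v + x w\<close> for the ends \<open>v, w\<close> of \<open>e\<close>. Hence the left kernel of the derivative has
  dimension \<open>V\<close> and is the same at all points, so that its elements are linear relations between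
  the components of \<open>G\<close> up to constants.
\<close>

subsection \<open>Permutations of the vertices of a 3-simplex\<close>

lemma UNIV_4_0123: "(UNIV :: 4 set) = {0, 1, 2, 3}"
proof -
  \<comment> \<open>The known enumeration of the type is \<open>1, 2, 3, 4\<close>, and
    \<open>4\<close> is \<open>0\<close> modulo 4.\<close>
  have "(4 :: 4) = 0" by simp
  then show ?thesis unfolding UNIV_4 by auto
qed

lemma exhaust_4_0123: "x = 0 \<or> x = 1 \<or> x = 2 \<or> x = (3 :: 4)"
  using UNIV_4_0123 by auto

lemma forall_4_0123: "(\<forall>x. P x) \<longleftrightarrow> P 0 \<and> P 1 \<and> P 2 \<and> P (3 :: 4)"
  by (metis exhaust_4_0123)

lemma neq_4 [simp]:
  "(0 :: 4) \<noteq> 1" "(0 :: 4) \<noteq> 2" "(0 :: 4) \<noteq> 3" "(1 :: 4) \<noteq> 2" "(1 :: 4) \<noteq> 3" "(2 :: 4) \<noteq> 3"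
  "(1 :: 4) \<noteq> 0" "(2 :: 4) \<noteq> 0" "(3 :: 4) \<noteq> 0" "(2 :: 4) \<noteq> 1" "(3 :: 4) \<noteq> 1" "(3 :: 4) \<noteq> 2"
  by simp_all

text \<open>For \<open>a \<noteq> b\<close>, the vertex \<open>d\<close> such that \<open>(a, b, c, d)\<close> is an even permutation of
  \<open>(0, 1, 2, 3)\<close> for the remaining vertex \<open>c\<close>, which is then \<open>fourth b a\<close>.\<close>

definition fourth :: "4 \<Rightarrow> 4 \<Rightarrow> 4" where
  "fourth a b =
     (if (a, b) \<in> {(0, 1), (1, 2), (2, 0)} then 3
      else if (a, b) \<in> {(1, 0), (0, 3), (3, 1)} then 2
      else if (a, b) \<in> {(0, 2), (2, 3), (3, 0)} then 1
      else 0)"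

lemma fourth_simps [simp]:
  "fourth 0 1 = 3" "fourth 1 2 = 3" "fourth 2 0 = 3"
  "fourth 1 0 = 2" "fourth 0 3 = 2" "fourth 3 1 = 2"
  "fourth 0 2 = 1" "fourth 2 3 = 1" "fourth 3 0 = 1"
  "fourth 2 1 = 0" "fourth 1 3 = 0" "fourth 3 2 = 0"
  by (simp_all add: fourth_def)

lemma fourth_cases:
  "\<forall>a b. a \<noteq> b \<longrightarrow> fourth a b \<noteq> a \<and> fourth a b \<noteq> b \<and> fourth a b \<noteq> fourth b a \<and>
     {a, b, fourth b a, fourth a b} = UNIV"
  unfolding forall_4_0123 UNIV_4_0123 by (simp add: insert_commute)

lemma fourth_neq:
  assumes "a \<noteq> b"
  shows "fourth a b \<noteq> a" "fourth a b \<noteq> b" "fourth a b \<noteq> fourth b a" "fourth b a \<noteq> a" "fourth b a \<noteq> b"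
  using fourth_cases[rule_format, OF assms] fourth_cases[rule_format, OF assms[symmetric]] by blast+

lemma fourth_UNIV: "a \<noteq> b \<Longrightarrow> {a, b, fourth b a, fourth a b} = UNIV"
  using fourth_cases[rule_format, of a b] by blast

text \<open>A transposition is odd, hence exchanges the roles of the two remaining vertices; all
  cases are enumerated. This is the inductive step of \<open>fourth_perm\<close>.\<close>

lemma fourth_transpose:
  "\<forall>i j a b. i \<noteq> j \<longrightarrow> a \<noteq> b \<longrightarrow> 
    fourth (Transposition.transpose i j a) (Transposition.transpose i j b) = Transposition.transpose i j (fourth b a)"
  unfolding forall_4_0123 by (simp add: Transposition.transpose_def)

text \<open>Even permutations preserve the parity of \<open>(a, b, c, d)\<close>, which
  characterizes \<open>d = fourth a b\<close>; odd ones reverse it and so put \<open>c\<close> in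
  its place. The proof builds \<open>\<pi>\<close> from transpositions.\<close>

lemma fourth_perm:
  assumes "bij \<pi>" "a \<noteq> b"
  shows "fourth (\<pi> a) (\<pi> b) = \<pi> (if evenperm \<pi> then fourth a b else fourth b a)"
proof -
  have "\<pi> permutes UNIV" "finite (UNIV :: 4 set)"
    using bij_imp_permutes[OF assms(1)] by auto
  then have "\<forall>a b. a \<noteq> b \<longrightarrow> fourth (\<pi> a) (\<pi> b) = \<pi> (if evenperm \<pi> then fourth a b else fourth b a)"
  proof (induction \<pi> rule: permutes_induct)
    case (swap i j p)
    have "permutation p"
      unfolding permutation_permutes by (intro exI[of _ UNIV] conjI finite swap.hyps(4))
    then have e: "evenperm (Transposition.transpose i j \<circ> p) = (\<not> evenperm p)"
      using swap.hyps(3) by (simp add: evenperm_comp evenperm_swap permutation_swap_id)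
    show ?case
    proof (intro allI impI)
      fix a b :: 4
      assume "a \<noteq> b"
      then have "p a \<noteq> p b" "fourth (p a) (p b) = p (if evenperm p then fourth a b else fourth b a)"
        "fourth (p b) (p a) = p (if evenperm p then fourth b a else fourth a b)"
        using swap.IH permutes_inj[OF swap.hyps(4)] by (auto simp: inj_eq)
      then show "fourth ((Transposition.transpose i j \<circ> p) a) ((Transposition.transpose i j \<circ> p) b) =
          (Transposition.transpose i j \<circ> p)
            (if evenperm (Transposition.transpose i j \<circ> p) then fourth a b else fourth b a)"
        unfolding e using fourth_transpose swap.hyps(3) by simp
    qed
  qed simp
  then show ?thesis using assms(2) by blast
qed

subsection \<open>Directed edges\<close>

text \<open>A triple \<open>(s, a, b)\<close> with \<open>a \<noteq> b\<close> stands for the edge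
  of \<open>s\<close> directed from \<open>a\<close> to \<open>b\<close>.\<close>

definition reverse :: "'t \<times> 4 \<times> 4 \<Rightarrow> 't \<times> 4 \<times> 4" where
  "reverse = (\<lambda>(s, a, b). (s, b, a))"

text \<open>Crossing the face opposite to \<open>fourth a b\<close> rotates around the edge; reversing the edge
  afterwards turns this rotation into an involution.\<close>

definition cross :: "'t gluing \<Rightarrow> 't \<times> 4 \<times> 4 \<Rightarrow> 't \<times> 4 \<times> 4" where
  "cross \<Phi> = (\<lambda>(s, a, b). let (t, \<pi>) = \<Phi> s (fourth a b) in (t, \<pi> b, \<pi> a))"

definition directed_edges :: "('t \<times> 4 \<times> 4) set" where
  "directed_edges = {(s, a, b). a \<noteq> b}"

lemma face_pairingD:
  assumes "face_pairing \<Phi>" "\<Phi> s f = (t, \<pi>)"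
  shows "bij \<pi>" "\<not> evenperm \<pi>" "(t, \<pi> f) \<noteq> (s, f)" "\<Phi> t (\<pi> f) = (s, inv \<pi>)"
  using assms unfolding face_pairing_def by blast+

lemma fourth_odd:
  assumes "face_pairing \<Phi>" "\<Phi> s f = (t, \<pi>)" "a \<noteq> b"
  shows "fourth (\<pi> a) (\<pi> b) = \<pi> (fourth b a)"
  using fourth_perm[of \<pi> a b] face_pairingD[OF assms(1,2)] assms(3) by simp

lemma face_pairing_neq:
  assumes "face_pairing \<Phi>" "\<Phi> s f = (t, \<pi>)" "a \<noteq> b"
  shows "\<pi> a \<noteq> \<pi> b"
  using face_pairingD(1)[OF assms(1,2)] assms(3) by (metis bij_is_inj inj_eq)

lemma reverse_involution [simp]: "reverse (reverse x) = x"
  by (cases x) (simp add: reverse_def)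

lemma reverse_directed [simp]: "reverse x \<in> directed_edges \<longleftrightarrow> x \<in> directed_edges"
  by (cases x) (auto simp: reverse_def directed_edges_def)

lemma reverse_neq: "x \<in> directed_edges \<Longrightarrow> reverse x \<noteq> x"
  by (cases x) (auto simp: reverse_def directed_edges_def)

text \<open>As \<open>\<pi>\<close> is odd, the image edge singles out the triangle opposite to
  \<open>\<pi> (fourth a b)\<close>, so that crossing again undoes the gluing. At a fixed point this
  triangle would be glued to itself, which \<open>face_pairing\<close> excludes.\<close>

lemma cross_facts:
  assumes \<Phi>: "face_pairing \<Phi>" and x: "x \<in> directed_edges"
  shows cross_directed: "cross \<Phi> x \<in> directed_edges"
    and cross_involution: "cross \<Phi> (cross \<Phi> x) = x"
    and cross_neq: "cross \<Phi> x \<noteq> x"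
proof -
  obtain s a b where [simp]: "x = (s, a, b)" by (cases x)
  obtain t \<pi> where g: "\<Phi> s (fourth a b) = (t, \<pi>)" by (cases "\<Phi> s (fourth a b)")
  have ab: "a \<noteq> b" using x by (simp add: directed_edges_def)
  note p = face_pairingD[OF \<Phi> g]
  have c: "cross \<Phi> x = (t, \<pi> b, \<pi> a)" using g by (simp add: cross_def)
  show "cross \<Phi> x \<in> directed_edges"
    unfolding c using face_pairing_neq[OF \<Phi> g ab] by (simp add: directed_edges_def)
  have f: "fourth (\<pi> b) (\<pi> a) = \<pi> (fourth a b)"
    using fourth_odd[OF \<Phi> g ab[symmetric]] .
  show "cross \<Phi> (cross \<Phi> x) = x"
    unfolding c using p(1,4) f by (simp add: cross_def bij_is_inj)
  show "cross \<Phi> x \<noteq> x"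
  proof
    assume "cross \<Phi> x = x"
    then have "(t, \<pi> b, \<pi> a) = (s, a, b)" unfolding c by simp
    then have "t = s" "\<pi> b = a" "\<pi> a = b" by blast+
    then have "\<pi> (fourth a b) = fourth a b" using f by (simp only:)
    then show False using p(3) \<open>t = s\<close> by blast
  qed
qed

text \<open>With \<open>F = r \<circ> G\<close> and \<open>y = F x\<close>, the equation \<open>(F ^^ k) x = r x\<close> implies
  \<open>(F ^^ (k - 2)) y = r y\<close>; this descends to a fixed point of \<open>r\<close> or of \<open>G\<close>.\<close>

lemma dihedral_no_reflection:
  assumes G: "\<And>x. x \<in> D \<Longrightarrow> G x \<in> D" "\<And>x. x \<in> D \<Longrightarrow> G (G x) = x" "\<And>x. x \<in> D \<Longrightarrow> G x \<noteq> x"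
    and r: "\<And>x. x \<in> D \<Longrightarrow> r x \<in> D" "\<And>x. x \<in> D \<Longrightarrow> r (r x) = x" "\<And>x. x \<in> D \<Longrightarrow> r x \<noteq> x"
    and x: "x \<in> D"
  shows "((\<lambda>x. r (G x)) ^^ k) x \<noteq> r x"
  using x
proof (induction k arbitrary: x rule: less_induct)
  case (less k)
  define F where "F = (\<lambda>x. r (G x))"
  have F: "(F ^^ n) z \<in> D" if "z \<in> D" for n z
    using that by (induction n) (auto simp: F_def G r)
  consider "k = 0" | "k = 1" | n where "k = Suc (Suc n)"
    by (metis One_nat_def not0_implies_Suc)
  then show ?case
  proof cases
    case 1 then show ?thesis using r(3)[OF less(2)] by simp
  next
    case 2
    have "r (r (G x)) \<noteq> r (r x)" using G(1,3) r(2) less(2) by simp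
    then show ?thesis using 2 by auto
  next
    case 3
    show ?thesis
    proof
      assume eq: "((\<lambda>x. r (G x)) ^^ k) x = r x"
      define y where "y = F x"
      have y: "y \<in> D" "r y = G x" using less(2) G r by (auto simp: y_def F_def)
      have "F ((F ^^ n) y) = (F ^^ Suc (Suc n)) x"
        unfolding y_def by (subst funpow_Suc_right) simp
      then have "F ((F ^^ n) y) = r x"
        using eq unfolding 3 by (simp only: F_def)
      then have "r (r (G ((F ^^ n) y))) = r (r x)" by (simp add: F_def)
      then have "G ((F ^^ n) y) = x"
        using r(2) G(1) F[OF y(1), of n] less(2) by simp
      then have "(F ^^ n) y = r y" using G(2)[OF F[OF y(1), of n]] y(2) by simp
      then show False using less(1)[of n y] y 3 by (simp add: F_def)
    qed
  qed
qed

text \<open>Rotation around an edge is the product of the involutions \<open>cross \<Phi>\<close>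
  and \<open>reverse\<close>, neither of which has a fixed point. In a dihedral action with this
  property no rotation agrees with a reflection at any point.\<close>

lemma rotation_no_reverse:
  assumes "face_pairing \<Phi>" "x \<in> directed_edges"
  shows "((\<lambda>x. reverse (cross \<Phi> x)) ^^ k) x \<noteq> reverse x"
  by (rule dihedral_no_reflection[where D = directed_edges])
    (use assms cross_facts[OF assms(1)] in \<open>auto simp: reverse_neq\<close>)

section \<open>Vertices of the links as orbits of directed edges under rotation\<close>

lemma face_cases:
  assumes "a \<noteq> b" "f \<notin> {a, b}"
  shows "f = fourth a b \<or> f = fourth b a"
  using fourth_UNIV[OF assms(1)] assms(2) by blast

text \<open>The point where the directed edge, leaving its start \<open>a\<close>, meets the link of
  \<open>a\<close>; it is a 0-cell of that link.\<close>

definition link_point :: "'t \<times> 4 \<times> 4 \<Rightarrow> 't \<times> 4 \<times> 4 set" where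
  "link_point = (\<lambda>(s, a, b). (s, a, {a, b}))"

lemma inj_on_link_point: "inj_on link_point directed_edges"
  by (auto simp: inj_on_def link_point_def directed_edges_def doubleton_eq_iff)

text \<open>Only two triangles of a 3-simplex contain a given edge. Crossing one of them rotates
  forwards, crossing the other rotates backwards.\<close>

lemma link_glued_pointD:
  assumes \<Phi>: "face_pairing \<Phi>" and x: "x \<in> directed_edges" and g: "(link_point x, y) \<in> link_glued \<Phi>"
  shows "y = link_point (reverse (cross \<Phi> x)) \<or> y = link_point (cross \<Phi> (reverse x))"
proof -
  obtain s a b where [simp]: "x = (s, a, b)" by (cases x)
  have ab: "a \<noteq> b" using x by (simp add: directed_edges_def)
  obtain f t \<pi> where f: "f \<notin> {a, b}" "\<Phi> s f = (t, \<pi>)" and y: "y = (t, \<pi> a, \<pi> ` {a, b})"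
    using g by (auto simp: link_glued_def link_point_def)
  from face_cases[OF ab f(1)] show ?thesis
  proof
    assume "f = fourth a b"
    then show ?thesis using f y by (simp add: cross_def reverse_def link_point_def)
  next
    assume "f = fourth b a"
    then show ?thesis using f y by (simp add: cross_def reverse_def link_point_def)
  qed
qed

text \<open>Forward and backward rotations are inverse to each other, so a chain of gluings reduces
  to one power. The disjunction stands for an integer exponent.\<close>

lemma link_class_rotation:
  assumes \<Phi>: "face_pairing \<Phi>" and x: "x \<in> directed_edges" and g: "(link_point x, p) \<in> (link_glued \<Phi>)\<^sup>*"
  shows "\<exists>y\<in>directed_edges. p = link_point y \<and>
    (\<exists>k. y = ((\<lambda>x. reverse (cross \<Phi> x)) ^^ k) x \<or> x = ((\<lambda>x. reverse (cross \<Phi> x)) ^^ k) y)"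
  using g
proof (induction rule: rtrancl_induct)
  case base
  show ?case using x by (auto intro!: bexI[of _ x] exI[of _ 0])
next
  case (step p q)
  define F where "F = (\<lambda>x. reverse (cross \<Phi> x))"
  define F' where "F' = (\<lambda>x. cross \<Phi> (reverse x))"
  note cf = cross_facts[OF \<Phi>]
  have FF': "F (F' z) = z" "F' (F z) = z" "F z \<in> directed_edges" "F' z \<in> directed_edges"
    if "z \<in> directed_edges" for z
    using that cf by (auto simp: F_def F'_def)
  obtain y k where y: "y \<in> directed_edges" "p = link_point y"
    and k: "y = (F ^^ k) x \<or> x = (F ^^ k) y"
    using step(3) by (auto simp: F_def)
  have q: "q = link_point (F y) \<or> q = link_point (F' y)"
    using link_glued_pointD[OF \<Phi> y(1)] step(2) y(2) by (simp add: F_def F'_def)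
  \<comment> \<open>A forward rotation lengthens a chain starting at \<open>x\<close> or shortens a
    chain leading back to \<open>x\<close>. With exponent 0 the first alternative holds already, so
    the second may assume \<open>k \<noteq> 0\<close>.\<close>
  have A: "\<exists>k. F y = (F ^^ k) x \<or> x = (F ^^ k) (F y)"
  proof (cases "y = (F ^^ k) x")
    case True
    then have "F y = (F ^^ Suc k) x" by simp
    then show ?thesis by blast
  next
    case False
    then have e: "x = (F ^^ k) y" "k \<noteq> 0" using k by (auto intro: gr0I)
    then obtain j where "k = Suc j" by (metis not0_implies_Suc)
    then have "x = (F ^^ j) (F y)" using e(1) by (simp del: funpow.simps add: funpow_Suc_right)
    then show ?thesis by blast
  qed
  have B: "\<exists>k. F' y = (F ^^ k) x \<or> x = (F ^^ k) (F' y)"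
  proof (cases "x = (F ^^ k) y")
    case True
    have "(F ^^ Suc k) (F' y) = (F ^^ k) (F (F' y))" by (simp del: funpow.simps add: funpow_Suc_right)
    then have "x = (F ^^ Suc k) (F' y)" using True FF'(1)[OF y(1)] by simp
    then show ?thesis by blast
  next
    case False
    then have e: "y = (F ^^ k) x" "k \<noteq> 0" using k by (auto intro: gr0I)
    then obtain j where j: "k = Suc j" by (metis not0_implies_Suc)
    have "(F ^^ j) x \<in> directed_edges" by (induction j) (auto simp: FF' x)
    then have "F' y = (F ^^ j) x" using e j FF' by simp
    then show ?thesis by blast
  qed
  from q show ?case
    unfolding F_def[symmetric]
  proof
    assume "q = link_point (F y)"
    with A FF'(3)[OF y(1)] show "\<exists>y\<in>directed_edges. q = link_point y \<and> (\<exists>k. y = (F ^^ k) x \<or> x = (F ^^ k) y)"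
      by (intro bexI[of _ "F y"] conjI)
  next
    assume "q = link_point (F' y)"
    with B FF'(4)[OF y(1)] show "\<exists>y\<in>directed_edges. q = link_point y \<and> (\<exists>k. y = (F ^^ k) x \<or> x = (F ^^ k) y)"
      by (intro bexI[of _ "F' y"] conjI)
  qed
qed

text \<open>The two ends of an edge give different points of the links, which is why each edge
  contributes exactly two link vertices. This is where orientation enters the count.\<close>

lemma link_no_reverse:
  assumes \<Phi>: "face_pairing \<Phi>" and "a \<noteq> b"
  shows "((s, a, {a, b}), (s, b, {a, b})) \<notin> (link_glued \<Phi>)\<^sup>*"
proof
  define x where "x = (s, a, b)"
  have x: "x \<in> directed_edges" "reverse x \<in> directed_edges"
    using assms(2) by (auto simp: x_def directed_edges_def reverse_def)
  have rx: "link_point (reverse x) = (s, b, {a, b})"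
    by (auto simp: x_def reverse_def link_point_def)
  assume "((s, a, {a, b}), (s, b, {a, b})) \<in> (link_glued \<Phi>)\<^sup>*"
  then have "(link_point x, link_point (reverse x)) \<in> (link_glued \<Phi>)\<^sup>*"
    unfolding rx by (simp add: x_def link_point_def)
  from link_class_rotation[OF \<Phi> x(1) this] obtain y k
    where y: "y \<in> directed_edges" "link_point (reverse x) = link_point y"
      "y = ((\<lambda>x. reverse (cross \<Phi> x)) ^^ k) x \<or> x = ((\<lambda>x. reverse (cross \<Phi> x)) ^^ k) y" by blast
  have "y = reverse x" using inj_onD[OF inj_on_link_point y(2)] x y(1) by simp
  then show False
    \<comment> \<open>The two directions are excluded by applying the lemma to \<open>x\<close> and
      to \<open>reverse x\<close>.\<close>
    using y(3) rotation_no_reverse[OF \<Phi> x(1), of k] rotation_no_reverse[OF \<Phi> x(2), of k]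
    by auto
qed

subsection \<open>The Neumann-Zagier symplectic form\<close>

lemma sum_rotation:
  fixes h :: "'t::finite \<times> 4 \<times> 4 \<Rightarrow> 'a::comm_monoid_add"
  assumes \<Phi>: "face_pairing \<Phi>"
  shows "(\<Sum>x\<in>directed_edges. h (reverse (cross \<Phi> x))) = (\<Sum>x\<in>directed_edges. h x)"
  by (rule sum.reindex_bij_witness[where i = "\<lambda>x. cross \<Phi> (reverse x)" and j = "\<lambda>x. reverse (cross \<Phi> x)"])
    (use cross_facts[OF \<Phi>] in auto)

text \<open>Weights on the edges of the quotient, pulled back to the edges of the separate
  3-simplices.\<close>

definition gluing_invariant :: "'t gluing \<Rightarrow> ('t \<Rightarrow> 4 set \<Rightarrow> 'a) \<Rightarrow> bool" where
  "gluing_invariant \<Phi> y \<longleftrightarrow> (\<forall>s f t \<pi> A. \<Phi> s f = (t, \<pi>) \<longrightarrow> f \<notin> A \<longrightarrow> card A = 2 \<longrightarrow> y t (\<pi> ` A) = y s A)"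

lemma gluing_invariantD:
  assumes "gluing_invariant \<Phi> y" "\<Phi> s f = (t, \<pi>)" "a \<noteq> b" "f \<noteq> a" "f \<noteq> b"
  shows "y t {\<pi> a, \<pi> b} = y s {a, b}"
  using assms(1)[unfolded gluing_invariant_def, rule_format, OF assms(2), of "{a, b}"] assms(3-5)
  by simp

definition quad_sum :: "(4 set \<Rightarrow> 'a::comm_monoid_add) \<Rightarrow> quad \<Rightarrow> 'a" where
  "quad_sum y q = (\<Sum>A\<in>quad_edges q. y A)"

text \<open>The contribution of one 3-simplex to the symplectic form: the determinant of the
  differences from a base type. It is alternating and unchanged when a constant is added to
  \<open>Y\<close> or \<open>W\<close>.\<close>

definition quad_form :: "(quad \<Rightarrow> 'a::comm_ring) \<Rightarrow> (quad \<Rightarrow> 'a) \<Rightarrow> 'a" where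
  "quad_form Y W = (Y Q02 - Y Q01) * (W Q03 - W Q01) - (Y Q03 - Y Q01) * (W Q02 - W Q01)"

lemma doubleton_4 [simp]:
  "{1, 0 :: 4} = {0, 1}" "{2, 0 :: 4} = {0, 2}" "{3, 0 :: 4} = {0, 3}"
  "{2, 1 :: 4} = {1, 2}" "{3, 1 :: 4} = {1, 3}" "{3, 2 :: 4} = {2, 3}"
  by auto

lemma quad_sum_simps:
  "quad_sum y Q01 = y {0, 1} + y {2, 3}"
  "quad_sum y Q02 = y {0, 2} + y {1, 3}"
  "quad_sum y Q03 = y {0, 3} + y {1, 2}"
  by (simp_all add: quad_sum_def doubleton_eq_iff)

lemma sum_pairs_4:
  "(\<Sum>(a, b)\<in>{(a, b). a \<noteq> b}. h a b) =
     h 0 1 + h 0 2 + h 0 3 + h 1 0 + h 1 2 + h 1 3 + h 2 0 + h 2 1 + h 2 3 + h 3 0 + h 3 1 + h 3 (2 :: 4)"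
  for h :: "4 \<Rightarrow> 4 \<Rightarrow> 'a::comm_monoid_add"
proof -
  have "{(a, b). a \<noteq> b} = {(0, 1), (0, 2), (0, 3), (1, 0), (1, 2), (1, 3), (2, 0), (2, 1), (2, 3),
      (3, 0), (3, 1), (3, 2 :: 4)}" (is "?L = ?R")
  proof -
    have "\<forall>a b. (a, b) \<in> ?L \<longleftrightarrow> (a, b) \<in> ?R" unfolding forall_4_0123 by simp
    then show ?thesis by auto
  qed
  then show ?thesis by (simp add: add.assoc)
qed

text \<open>Expansion leaves 24 products of weights of two edges of different types. Such edges
  share a vertex \<open>b\<close>, and the sign depends on which of the two remaining vertices is
  the far end of the second edge.\<close>

lemma quad_form_directed:
  fixes y w :: "4 set \<Rightarrow> 'a::comm_ring"
  shows "quad_form (quad_sum y) (quad_sum w) =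
    (\<Sum>(a, b)\<in>{(a, b). a \<noteq> b}. y {a, b} * w {b, fourth a b}) -
    (\<Sum>(a, b)\<in>{(a, b). a \<noteq> b}. y {a, b} * w {b, fourth b a})"
  unfolding sum_pairs_4 quad_form_def quad_sum_simps by (simp add: algebra_simps)

text \<open>The two sums of \<open>quad_form_directed\<close> are exchanged by the rotation around the edges.\<close>

lemma sum_quad_form_zero:
  fixes y w :: "'t::finite \<Rightarrow> 4 set \<Rightarrow> 'a::comm_ring"
  assumes \<Phi>: "face_pairing \<Phi>" and y: "gluing_invariant \<Phi> y" and w: "gluing_invariant \<Phi> w"
  shows "(\<Sum>s\<in>UNIV. quad_form (quad_sum (y s)) (quad_sum (w s))) = 0"
proof -
  have D: "directed_edges = UNIV \<times> {(a, b). a \<noteq> b}" by (auto simp: directed_edges_def)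
  have "(\<Sum>(s, a, b)\<in>directed_edges. y s {a, b} * w s {b, fourth a b}) =
      (\<Sum>x\<in>directed_edges. (\<lambda>(s, a, b). y s {a, b} * w s {b, fourth a b}) (reverse (cross \<Phi> x)))"
    by (rule sum_rotation[OF \<Phi>, symmetric])
  also have "\<dots> = (\<Sum>(s, a, b)\<in>directed_edges. y s {a, b} * w s {b, fourth b a})"
  proof (rule sum.cong, simp, clarify)
    fix s a b assume "(s, a, b) \<in> (directed_edges :: ('t \<times> 4 \<times> 4) set)"
    then have ab: "a \<noteq> b" by (simp add: directed_edges_def)
    obtain t \<pi> where g: "\<Phi> s (fourth a b) = (t, \<pi>)" by (cases "\<Phi> s (fourth a b)")
    have c: "reverse (cross \<Phi> (s, a, b)) = (t, \<pi> a, \<pi> b)"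
      using g by (simp add: cross_def reverse_def)
    have 1: "y t {\<pi> a, \<pi> b} = y s {a, b}"
      by (rule gluing_invariantD[OF y g ab]) (use fourth_neq[OF ab] in auto)
    \<comment> \<open>Both edges lie in the triangle opposite to \<open>fourth a b\<close>, so the
      gluing preserves their weights. As \<open>\<pi>\<close> is odd,
      \<open>\<pi> (fourth b a)\<close> is \<open>fourth (\<pi> a) (\<pi> b)\<close>, which turns
      one sum into the other.\<close>
    have "w t {\<pi> b, \<pi> (fourth b a)} = w s {b, fourth b a}"
      by (rule gluing_invariantD[OF w g]) (use fourth_neq[OF ab] in auto)
    with 1 show "(case reverse (cross \<Phi> (s, a, b)) of (s, a, b) \<Rightarrow> y s {a, b} * w s {b, fourth a b}) =
        y s {a, b} * w s {b, fourth b a}"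
      unfolding c using fourth_odd[OF \<Phi> g ab] by simp
  qed
  finally show ?thesis
    unfolding quad_form_directed sum_subtractf D sum.cartesian_product[symmetric] by simp
qed

subsection \<open>Row bases and regular level sets\<close>

lemma vec_dim_direct_sum:
  fixes A B :: "('a::field ^ 'n) set"
  assumes "vec.subspace A" "vec.subspace B" "A \<inter> B = {0}"
  shows "vec.dim {x + y |x y. x \<in> A \<and> y \<in> B} = vec.dim A + vec.dim B"
  using vec.dim_sums_Int[OF assms(1,2)] assms(3) by simp

lemma vec_nth_sum_axis:
  fixes c :: "'b::finite \<Rightarrow> 'a::field"
  shows "(\<Sum>j\<in>J. c j *s axis j 1) $ e = (if e \<in> J then c e else 0)"
proof -
  have "(\<Sum>j\<in>J. c j *s axis j 1) $ e = (\<Sum>j\<in>J. if j = e then c j else 0)"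
    unfolding sum_component by (rule sum.cong) (auto simp: axis_def)
  also have "\<dots> = (if e \<in> J then c e else 0)"
    by (simp add: sum.delta)
  finally show ?thesis .
qed

text \<open>\<open>J\<close> indexes a basis of the span of the rows. The vectors supported on
  \<open>E\<close> are then the direct sum of the left kernel \<open>K\<close> and the vectors
  supported on \<open>J\<close>, whence the dimension count. Dependence of the other rows on
  \<open>J\<close> is put as membership in \<open>K\<close>, so that it can be turned into relations
  between functions.\<close>

lemma row_basis:
  fixes R :: "'b::finite \<Rightarrow> 'a::field ^ 'n" and E :: "'b set"
  defines "K \<equiv> {y :: 'a ^ 'b. (\<forall>e. e \<notin> E \<longrightarrow> y $ e = 0) \<and> (\<Sum>e\<in>E. y $ e *s R e) = 0}"
  obtains J where "J \<subseteq> E" "inj_on R J" "vec.independent (R ` J)"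
    "card J + vec.dim K = card E"
    "\<And>e. e \<in> E \<Longrightarrow> \<exists>c. (axis e 1 - (\<Sum>j\<in>J. c j *s axis j 1)) \<in> K"
proof -
  obtain B where B: "B \<subseteq> R ` E" "vec.independent B" "R ` E \<subseteq> vec.span B"
    using vec.maximal_independent_subset by blast
  then obtain J where J: "J \<subseteq> E" "inj_on R J" "B = R ` J"
    using subset_image_inj by metis
  define N where "N = {y :: 'a ^ 'b. \<forall>e. e \<notin> J \<longrightarrow> y $ e = 0}"
  have supp_sum: "(\<Sum>e\<in>E. y $ e *s R e) = (\<Sum>e\<in>UNIV. y $ e *s R e)"
    if "\<forall>e. e \<notin> E \<longrightarrow> y $ e = 0" for y :: "'a ^ 'b"
    by (rule sum.mono_neutral_left) (use that in auto)
  have subK: "vec.subspace K"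
  proof (rule vec.subspaceI)
    fix x y :: "'a ^ 'b" and c :: 'a
    assume x: "x \<in> K" and y: "y \<in> K"
    show "x + y \<in> K" using x y
      by (simp add: K_def vec.scale_left_distrib sum.distrib)
    have "(\<Sum>e\<in>E. (c *s x) $ e *s R e) = c *s (\<Sum>e\<in>E. x $ e *s R e)"
      by (simp add: vec.scale_sum_right)
    then show "c *s x \<in> K" using x by (simp add: K_def)
  qed (simp add: K_def)
  have subN: "vec.subspace N"
    by (auto simp: N_def vec.subspace_def)
  have span: "\<exists>c. R e = (\<Sum>j\<in>J. c j *s R j)" if "e \<in> E" for e
  proof -
    have "R e \<in> vec.span (R ` J)" using B J that by auto
    then obtain u where "R e = (\<Sum>v\<in>R ` J. u v *s v)"
      using vec.span_finite[of "R ` J"] by auto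
    then have "R e = (\<Sum>j\<in>J. u (R j) *s R j)"
      by (simp add: sum.reindex[OF J(2)])
    then show ?thesis by (rule exI[of _ "\<lambda>j. u (R j)"])
  qed
  have comb: "(\<Sum>e\<in>UNIV. (\<Sum>j\<in>J. c j *s axis j 1) $ e *s R e) = (\<Sum>j\<in>J. c j *s R j)" for c
    unfolding vec_nth_sum_axis by (rule sum.mono_neutral_cong_right) auto
  have inK: "(axis e 1 - (\<Sum>j\<in>J. c j *s axis j 1)) \<in> K"
    if e: "e \<in> E" and c: "R e = (\<Sum>j\<in>J. c j *s R j)" for e c
  proof -
    define y where "y = axis e 1 - (\<Sum>j\<in>J. c j *s axis j 1)"
    have s: "\<forall>e'. e' \<notin> E \<longrightarrow> y $ e' = 0"
      unfolding y_def vector_minus_component vec_nth_sum_axis using e J(1) by (auto simp: axis_def)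
    have "(\<Sum>e'\<in>UNIV. axis e 1 $ e' *s R e') = (\<Sum>e'\<in>UNIV. if e' = e then R e' else 0)"
      by (rule sum.cong) (auto simp: axis_def)
    then have "(\<Sum>e'\<in>UNIV. axis e 1 $ e' *s R e') = R e"
      by simp
    then have "(\<Sum>e'\<in>UNIV. y $ e' *s R e') = 0"
      unfolding y_def vector_minus_component vec.scale_left_diff_distrib sum_subtractf comb
      using c by simp
    then show ?thesis using s supp_sum[OF s] by (auto simp: K_def y_def)
  qed
  have int: "K \<inter> N = {0}"
  proof -
    have "y = 0" if y: "y \<in> K" "y \<in> N" for y
    proof -
      have "(\<Sum>j\<in>J. y $ j *s R j) = 0"
      proof -
        have "(\<Sum>j\<in>J. y $ j *s R j) = (\<Sum>e\<in>E. y $ e *s R e)"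
          by (rule sum.mono_neutral_left) (use J y in \<open>auto simp: N_def\<close>)
        then show ?thesis using y by (simp add: K_def)
      qed
      then have "(\<Sum>v\<in>R ` J. (y $ the_inv_into J R v) *s v) = 0"
        by (simp add: sum.reindex[OF J(2)] the_inv_into_f_f[OF J(2)])
      then have "\<forall>v\<in>R ` J. y $ the_inv_into J R v = 0"
        using B(2) J(3) vec.dependent_finite[of "R ` J"] by auto
      then have "y $ j = 0" if "j \<in> J" for j
        using that the_inv_into_f_f[OF J(2)] by fastforce
      then show ?thesis using y by (auto simp: N_def vec_eq_iff)
    qed
    then show ?thesis using subK subN by (auto simp: vec.subspace_0)
  qed
  have sums: "{x + y |x y. x \<in> K \<and> y \<in> N} = {y. \<forall>e. e \<notin> E \<longrightarrow> y $ e = 0}" (is "?L = ?R")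
  proof (intro equalityI subsetI)
    fix y assume "y \<in> ?L" then show "y \<in> ?R" using J(1) by (auto simp: K_def N_def)
  next
    fix y assume y: "y \<in> ?R"
    obtain c where c: "\<And>e. e \<in> E \<Longrightarrow> R e = (\<Sum>j\<in>J. c e j *s R j)"
      using span by metis
    \<comment> \<open>Replacing every \<open>axis e 1\<close> by its expression over
      \<open>J\<close> changes \<open>y\<close> by an element of \<open>K\<close>.\<close>
    define k where "k = (\<Sum>e\<in>E. y $ e *s (axis e 1 - (\<Sum>j\<in>J. c e j *s axis j 1)))"
    have k: "k \<in> K"
      unfolding k_def using inK c
      by (intro vec.subspace_sum[OF subK] vec.subspace_scale[OF subK]) auto
    have "y - k \<in> N"
    proof -
      have "k $ e = y $ e" if "e \<notin> J" for e
      proof -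
        have "k $ e = (\<Sum>e'\<in>E. (y $ e' *s (axis e' 1 - (\<Sum>j\<in>J. c e' j *s axis j 1))) $ e)"
          unfolding k_def by (rule sum_component)
        also have "\<dots> = (\<Sum>e'\<in>E. if e' = e then y $ e' else 0)"
          unfolding vector_smult_component vector_minus_component vec_nth_sum_axis
          by (rule sum.cong) (use that in \<open>auto simp: axis_def\<close>)
        also have "\<dots> = y $ e" using y by auto
        finally show ?thesis .
      qed
      then show ?thesis by (simp add: N_def)
    qed
    moreover have "y = k + (y - k)" by simp
    ultimately show "y \<in> ?L" using k by blast
  qed
  have "card E = vec.dim K + card J"
    using vec_dim_direct_sum[OF subK subN int] unfolding sums
    using dim_substandard_cart[of E, where 'a='a] dim_substandard_cart[of J, where 'a='a] by (simp add: N_def)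
  moreover have "\<exists>c. axis e 1 - (\<Sum>j\<in>J. c j *s axis j 1) \<in> K" if "e \<in> E" for e
    using span[OF that] inK[OF that] by blast
  ultimately show thesis
    using J(1,2) B(2)[unfolded J(3)] by (intro that[of J]) auto
qed

text \<open>The complex bilinear pairing, in contrast to \<open>\<bullet>\<close>, which is the real
  inner product on complex vectors.\<close>

definition dot :: "'a::comm_semiring_1 ^ 'n \<Rightarrow> 'a ^ 'n \<Rightarrow> 'a" where
  "dot a v = (\<Sum>s\<in>UNIV. a $ s * v $ s)"

lemma matrix_vector_mult_dot: "(A *v v) $ i = dot (A $ i) v"
  by (simp add: matrix_vector_mult_def dot_def)

lemma bounded_linear_dot: "bounded_linear (dot (a :: complex ^ 'n))"
  unfolding dot_def[abs_def]
  by (intro bounded_linear_sum bounded_linear_const_mult bounded_linear_vec_nth)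

lemma dot_eq_zero_of_span:
  fixes v :: "'a::field ^ 'n"
  assumes "vec.span B = UNIV" "\<And>b. b \<in> B \<Longrightarrow> dot b v = 0"
  shows "v = 0"
proof -
  have "vec.subspace {b. dot b v = 0}"
    by (auto simp: vec.subspace_def dot_def distrib_right sum.distrib mult.assoc simp flip: sum_distrib_left)
  then have "vec.span B \<subseteq> {b. dot b v = 0}"
    using assms(2) by (intro vec.span_minimal) auto
  then have d: "dot (axis i 1) v = 0" for i using assms(1) by auto
  have "dot (axis i 1) v = (\<Sum>s\<in>UNIV. if s = i then v $ s else 0)" for i
    unfolding dot_def by (rule sum.cong) (auto simp: axis_def)
  then show ?thesis using d by (simp add: vec_eq_iff)
qed

text \<open>Passing from matrices to bounded operators is linear in finite dimension, hence
  continuous. This is the form of continuity that the inverse function theorem asks for.\<close>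

lemma continuous_on_Blinfun_matrix:
  fixes M :: "'b::topological_space \<Rightarrow> complex ^ 'n ^ 'n"
  assumes "continuous_on U M"
  shows "continuous_on U (\<lambda>w. Blinfun ((*v) (M w)))"
proof -
  have ap: "blinfun_apply (Blinfun ((*v) A)) = (*v) A" for A :: "complex ^ 'n ^ 'n"
    by (rule bounded_linear_Blinfun_apply) simp
  have "linear (\<lambda>A :: complex ^ 'n ^ 'n. Blinfun ((*v) A))"
    by (rule linearI)
      (auto intro!: blinfun_eqI simp: ap blinfun.add_left blinfun.scaleR_left matrix_vector_mult_add_rdistrib
        matrix_vector_mult_def vec_eq_iff scaleR_sum_right distrib_right sum.distrib)
  then have "bounded_linear (\<lambda>A :: complex ^ 'n ^ 'n. Blinfun ((*v) A))"
    by (simp add: linear_conv_bounded_linear)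
  from bounded_linear.continuous_on[OF this assms] show ?thesis .
qed

text \<open>The inverse function theorem is applied over the reals; this makes the local inverse
  holomorphic.\<close>

lemma inv_complex_linear:
  fixes f :: "complex ^ 'n \<Rightarrow> complex ^ 'n"
  assumes "bij f" "\<And>c v. f (c *s v) = c *s f v"
  shows "inv f (c *s v) = c *s inv f v"
proof -
  have "f (c *s inv f v) = c *s v" using assms by (simp add: bij_is_surj surj_f_inv_f)
  then show ?thesis using assms(1) by (metis bij_inv_eq_iff)
qed

lemma has_derivative_vecI:
  fixes f :: "'a::real_normed_vector \<Rightarrow> 'b::euclidean_space ^ 'n"
  assumes "\<And>i. ((\<lambda>x. f x $ i) has_derivative (\<lambda>v. f' v $ i)) (at a within S)"
  shows "(f has_derivative f') (at a within S)"
  unfolding has_derivative_componentwise_within[of f]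
proof
  fix b :: "'b ^ 'n" assume "b \<in> Basis"
  then obtain i u where "b = axis i u" by (auto simp: Basis_vec_def)
  then show "((\<lambda>x. f x \<bullet> b) has_derivative (\<lambda>v. f' v \<bullet> b)) (at a within S)"
    using has_derivative_inner_left[OF assms, of i u] by (simp add: inner_axis)
qed

text \<open>The derivatives at \<open>x\<close> are completed to a basis, and the added vectors
  supply linear coordinates. Together with the given functions these form a map whose derivative at
  \<open>x\<close> is invertible, so it is a local chart.\<close>

lemma regular_level_set_chart:
  fixes F :: "'b \<Rightarrow> complex ^ 'n \<Rightarrow> complex" and D :: "'b \<Rightarrow> complex ^ 'n \<Rightarrow> complex ^ 'n"
  assumes U: "open U" "x \<in> U"
    and der: "\<And>e w. e \<in> J \<Longrightarrow> w \<in> U \<Longrightarrow> (F e has_derivative dot (D e w)) (at w)"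
    and cont: "\<And>e. e \<in> J \<Longrightarrow> continuous_on U (D e)"
    and inj: "inj_on (\<lambda>e. D e x) J" and ind: "vec.independent ((\<lambda>e. D e x) ` J)"
  obtains U' W \<phi> \<psi> and S :: "'n set" where
    "open U'" "x \<in> U'" "open W" "holomorphic_map_on \<phi> U'" "holomorphic_map_on \<psi> W"
    "\<phi> ` U' = W" "\<psi> ` W = U'" "\<And>y. y \<in> U' \<Longrightarrow> \<psi> (\<phi> y) = y" "\<And>w. w \<in> W \<Longrightarrow> \<phi> (\<psi> w) = w"
    "card S + card J = CARD('n)"
    "\<phi> ` ({w \<in> U. \<forall>e\<in>J. F e w = c e} \<inter> U') = {w \<in> W. \<forall>i. i \<notin> S \<longrightarrow> w $ i = 0}"
proof -
  define B0 where "B0 = (\<lambda>e. D e x) ` J"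
  obtain B where B: "B0 \<subseteq> B" "vec.independent B" and "UNIV \<subseteq> vec.span B"
    unfolding B0_def by (rule vec.maximal_independent_subset_extend[OF subset_UNIV ind])
  then have span: "vec.span B = UNIV"
    by (simp add: top.extremum_uniqueI)
  have finB: "finite B" by (rule vec.finiteI_independent[OF B(2)])
  have "vec.dim (UNIV :: (complex ^ 'n) set) = card B"
    by (rule vec.dim_eq_card[OF _ B(2)]) (simp add: span)
  then have cB: "card B = CARD('n)" unfolding vec_dim_card by (rule sym)
  \<comment> \<open>\<open>\<beta>\<close> labels the basis by coordinates: the indices of the added
    vectors form \<open>S\<close> and become the free coordinates, while \<open>\<epsilon>\<close>
    gives the equation belonging to each other index.\<close>
  obtain \<beta> where \<beta>: "bij_betw \<beta> (UNIV :: 'n set) B"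
    using finite_same_card_bij[of "UNIV :: 'n set" B] cB finB by auto
  define S where "S = {i. \<beta> i \<notin> B0}"
  define \<epsilon> where "\<epsilon> i = the_inv_into J (\<lambda>e. D e x) (\<beta> i)" for i
  have \<epsilon>: "\<epsilon> i \<in> J" "D (\<epsilon> i) x = \<beta> i" if "i \<notin> S" for i
    using that the_inv_into_into[OF inj, of "\<beta> i" J] f_the_inv_into_f[OF inj, of "\<beta> i"]
    by (auto simp: S_def B0_def \<epsilon>_def)
  have \<epsilon>_surj: "\<exists>i. i \<notin> S \<and> \<epsilon> i = e" if "e \<in> J" for e
  proof -
    have "D e x \<in> B" using that B(1) by (auto simp: B0_def)
    then obtain i where "\<beta> i = D e x" using \<beta> by (metis bij_betw_imp_surj_on imageE)
    then show ?thesis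
      using that by (auto simp: S_def B0_def \<epsilon>_def the_inv_into_f_f[OF inj])
  qed
  have "card J = card (- S)"
  proof -
    have "inj_on \<beta> (- S)" using \<beta> by (meson bij_betw_imp_inj_on inj_on_subset subset_UNIV)
    moreover have "\<beta> ` (- S) = B0"
      using B(1) \<beta> by (auto simp: S_def bij_betw_def)
    ultimately have "card (- S) = card B0" by (metis card_image)
    then show ?thesis by (simp add: B0_def card_image[OF inj])
  qed
  then have cS: "card S + card J = CARD('n)"
    by (metis card_Un_disjoint Compl_partition Compl_disjoint finite)
  \<comment> \<open>On \<open>S\<close> the coordinates are linear and vanish at \<open>x\<close>;
    off \<open>S\<close> they are the equations. \<open>M w\<close> is the Jacobian matrix, whose
    rows at \<open>x\<close> are the basis.\<close>
  define \<phi> where "\<phi> w = (\<chi> i. if i \<in> S then dot (\<beta> i) w - dot (\<beta> i) x else F (\<epsilon> i) w - c (\<epsilon> i))" for w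
  define M where "M w = (\<chi> i. if i \<in> S then \<beta> i else D (\<epsilon> i) w)" for w
  have ap: "blinfun_apply (Blinfun ((*v) A)) = (*v) A" for A :: "complex ^ 'n ^ 'n"
    by (rule bounded_linear_Blinfun_apply) simp
  have der\<phi>: "(\<phi> has_derivative (*v) (M w)) (at w)" if w: "w \<in> U" for w
  proof -
    have "((\<lambda>w. \<phi> w $ i) has_derivative (\<lambda>v. (M w *v v) $ i)) (at w)" for i
    proof (cases "i \<in> S")
      case True
      have "((\<lambda>w. dot (\<beta> i) w - dot (\<beta> i) x) has_derivative (\<lambda>v. dot (\<beta> i) v - 0)) (at w)"
        by (intro has_derivative_diff bounded_linear_imp_has_derivative bounded_linear_dot has_derivative_const)
      then show ?thesis using True by (simp add: \<phi>_def M_def matrix_vector_mult_dot)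
    next
      case False
      have "((\<lambda>w. F (\<epsilon> i) w - c (\<epsilon> i)) has_derivative (\<lambda>v. dot (D (\<epsilon> i) w) v - 0)) (at w)"
        by (intro has_derivative_diff der \<epsilon> False w has_derivative_const)
      then show ?thesis using False by (simp add: \<phi>_def M_def matrix_vector_mult_dot)
    qed
    then show ?thesis by (rule has_derivative_vecI)
  qed
  have contM: "continuous_on U (\<lambda>w. Blinfun ((*v) (M w)))"
    unfolding M_def
  proof (intro continuous_on_Blinfun_matrix continuous_on_vec_lambda)
    show "continuous_on U (\<lambda>w. if i \<in> S then \<beta> i else D (\<epsilon> i) w)" for i
      by (cases "i \<in> S") (auto intro: cont \<epsilon>)
  qed
  have Mx: "M x $ i = \<beta> i" for i using \<epsilon>(2) by (simp add: M_def)
  \<comment> \<open>The rows of \<open>M x\<close> span, so its kernel is trivial; the resulting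
    left inverse is what the inverse function theorem needs.\<close>
  have "v = 0" if "M x *v v = 0" for v
  proof (rule dot_eq_zero_of_span[OF span])
    fix b assume "b \<in> B"
    then obtain i where "b = \<beta> i" using \<beta> by (metis bij_betw_imp_surj_on imageE)
    then show "dot b v = 0"
      using arg_cong[OF that, of "\<lambda>y. y $ i"] by (simp add: matrix_vector_mult_dot Mx)
  qed
  then obtain N where N: "N ** M x = mat 1"
    using matrix_left_invertible_ker[of "M x"] by blast
  have invf: "Blinfun ((*v) N) o\<^sub>L Blinfun ((*v) (M x)) = id_blinfun"
    by (rule blinfun_eqI) (simp add: ap matrix_vector_mul_assoc N)
  have der\<phi>': "(\<phi> has_derivative blinfun_apply (Blinfun ((*v) (M w)))) (at w)" if "w \<in> U" for w
    unfolding ap by (rule der\<phi>[OF that])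
  obtain U' V g g' where g: "open U'" "U' \<subseteq> U" "x \<in> U'" "open V" "\<phi> x \<in> V" "homeomorphism U' V \<phi> g"
    "\<And>y. y \<in> V \<Longrightarrow> (g has_derivative (g' y)) (at y)"
    "\<And>y. y \<in> V \<Longrightarrow> g' y = inv (blinfun_apply (Blinfun ((*v) (M (g y)))))"
    "\<And>y. y \<in> V \<Longrightarrow> bij (blinfun_apply (Blinfun ((*v) (M (g y)))))"
  proof (rule inverse_function_theorem[OF U(1) der\<phi>' contM U(2) invf])
    fix U' V g g'
    assume "open U'" "U' \<subseteq> U" "x \<in> U'" "open V" "\<phi> x \<in> V" "homeomorphism U' V \<phi> g"
      "\<And>y. y \<in> V \<Longrightarrow> (g has_derivative (g' y)) (at y)"
      "\<And>y. y \<in> V \<Longrightarrow> g' y = inv (blinfun_apply (Blinfun ((*v) (M (g y)))))"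
      "\<And>y. y \<in> V \<Longrightarrow> bij (blinfun_apply (Blinfun ((*v) (M (g y)))))"
    then show thesis by (rule that)
  qed
  note h = homeomorphism_image1[OF g(6)] homeomorphism_image2[OF g(6)]
    homeomorphism_apply1[OF g(6)] homeomorphism_apply2[OF g(6)]
  have hol\<phi>: "holomorphic_map_on \<phi> U'"
    unfolding holomorphic_map_on_def using der\<phi> g(2)
    by (blast intro: vec.linear_scale[OF matrix_vector_mul_linear_gen])
  have hol\<psi>: "holomorphic_map_on g V"
    unfolding holomorphic_map_on_def
  proof
    fix y assume y: "y \<in> V"
    have "g' y (c *s v) = c *s g' y v" for c v
      unfolding g(8)[OF y] using g(9)[OF y] unfolding ap
      by (rule inv_complex_linear) (rule vec.linear_scale[OF matrix_vector_mul_linear_gen])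
    then show "\<exists>f'. (g has_derivative f') (at y) \<and> (\<forall>c v. f' (c *s v) = c *s f' v)"
      using g(7)[OF y] by blast
  qed
  have zero: "(\<forall>i. i \<notin> S \<longrightarrow> \<phi> w $ i = 0) \<longleftrightarrow> (\<forall>e\<in>J. F e w = c e)" for w
    using \<epsilon>(1) \<epsilon>_surj by (fastforce simp: \<phi>_def)
  have "\<phi> ` ({w \<in> U. \<forall>e\<in>J. F e w = c e} \<inter> U') = {w \<in> V. \<forall>i. i \<notin> S \<longrightarrow> w $ i = 0}"
  proof (intro equalityI subsetI)
    fix y assume "y \<in> \<phi> ` ({w \<in> U. \<forall>e\<in>J. F e w = c e} \<inter> U')"
    then obtain w where "y = \<phi> w" "w \<in> U'" "\<forall>e\<in>J. F e w = c e" by auto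
    then show "y \<in> {w \<in> V. \<forall>i. i \<notin> S \<longrightarrow> w $ i = 0}" using zero[of w] h(1) by auto
  next
    fix y assume y: "y \<in> {w \<in> V. \<forall>i. i \<notin> S \<longrightarrow> w $ i = 0}"
    then have "y = \<phi> (g y)" "g y \<in> U'" using h(2,4) by auto
    then show "y \<in> \<phi> ` ({w \<in> U. \<forall>e\<in>J. F e w = c e} \<inter> U')"
      using y zero[of "g y"] g(2) by (intro image_eqI[of _ _ "g y"]) auto
  qed
  with g(1,3,4) hol\<phi> hol\<psi> h cS show thesis by (intro that[of U' V \<phi> g S]) auto
qed

subsection \<open>Edge and vertex classes\<close>

lemma sym_glued:
  assumes "face_pairing \<Phi>"
  shows "sym (glued \<Phi>)"
proof (rule symI)
  fix p q assume "(p, q) \<in> glued \<Phi>"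
  then obtain s A f t \<pi> where g: "\<Phi> s f = (t, \<pi>)" "f \<notin> A" and [simp]: "p = (s, A)" "q = (t, \<pi> ` A)"
    by (auto simp: glued_def)
  note b = face_pairingD[OF assms g(1)]
  have "\<pi> f \<notin> \<pi> ` A" using g(2) b(1) by (auto simp: bij_is_inj inj_eq)
  moreover have "A = inv \<pi> ` \<pi> ` A" using b(1) by (simp add: image_inv_f_f bij_is_inj)
  ultimately show "(q, p) \<in> glued \<Phi>"
    unfolding glued_def using b(4) by auto
qed

lemma equiv_glued: "face_pairing \<Phi> \<Longrightarrow> equiv UNIV ((glued \<Phi>)\<^sup>*)"
  by (intro equivI refl_rtrancl sym_rtrancl sym_glued trans_rtrancl) simp

definition cell_class :: "'t gluing \<Rightarrow> 't \<Rightarrow> 4 set \<Rightarrow> 't subsimplex set" where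
  "cell_class \<Phi> s A = (glued \<Phi>)\<^sup>* `` {(s, A)}"

lemma cell_class_glue:
  assumes "face_pairing \<Phi>" "\<Phi> s f = (t, \<pi>)" "f \<notin> A"
  shows "cell_class \<Phi> t (\<pi> ` A) = cell_class \<Phi> s A"
proof -
  have "((s, A), (t, \<pi> ` A)) \<in> (glued \<Phi>)\<^sup>*"
    using assms(2,3) by (intro r_into_rtrancl) (auto simp: glued_def)
  then show ?thesis
    unfolding cell_class_def using equiv_class_eq[OF equiv_glued[OF assms(1)]] by metis
qed

lemma cell_class_in_edges: "card A = 2 \<Longrightarrow> cell_class \<Phi> s A \<in> edges \<Phi>"
  by (auto simp: edges_def cell_class_def intro: quotientI)

lemma cell_class_in_vertices: "cell_class \<Phi> s {a} \<in> vertices \<Phi>"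
  by (auto simp: vertices_def cell_class_def intro: quotientI)

lemma edgesE:
  assumes "e \<in> edges \<Phi>"
  obtains s a b where "a \<noteq> b" "e = cell_class \<Phi> s {a, b}"
  using assms by (auto simp: edges_def cell_class_def elim!: quotientE simp: card_2_iff)

lemma verticesE:
  assumes "v \<in> vertices \<Phi>"
  obtains s a where "v = cell_class \<Phi> s {a}"
  using assms by (auto simp: vertices_def cell_class_def elim!: quotientE simp: card_1_singleton_iff)

lemma mem_edge_iff:
  assumes "face_pairing \<Phi>" "e \<in> edges \<Phi>"
  shows "(s, A) \<in> e \<longleftrightarrow> e = cell_class \<Phi> s A"
proof -
  obtain t B where e: "e = (glued \<Phi>)\<^sup>* `` {(t, B)}"
    using assms(2) by (auto simp: edges_def elim!: quotientE)
  show ?thesis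
    unfolding e cell_class_def using eq_equiv_class_iff[OF equiv_glued[OF assms(1)]] by blast
qed

lemma cell_class_invariant:
  assumes "face_pairing \<Phi>" and y: "gluing_invariant \<Phi> y" and "card A = 2"
    and "((s, A), (t, B)) \<in> (glued \<Phi>)\<^sup>*"
  shows "y t B = y s A"
proof -
  have "(case p of (t, B) \<Rightarrow> y t B = y s A \<and> card B = 2)" if "((s, A), p) \<in> (glued \<Phi>)\<^sup>*" for p
    using that
  proof (induction rule: rtrancl_induct)
    case (step p q)
    obtain t B f t' \<pi> where g: "\<Phi> t f = (t', \<pi>)" "f \<notin> B" and [simp]: "p = (t, B)" "q = (t', \<pi> ` B)"
      using step(2) by (auto simp: glued_def)
    have "card (\<pi> ` B) = card B"
      using face_pairingD(1)[OF assms(1) g(1)] by (metis bij_is_inj card_image inj_on_subset subset_UNIV)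
    then show ?case using step(3) y[unfolded gluing_invariant_def, rule_format, OF g] by simp
  qed (simp add: assms(3))
  then show ?thesis using assms(4) by blast
qed

subsection \<open>The left kernel of the derivative\<close>

lemma quad_cases: "q \<in> {p, next_quad p, next_quad (next_quad p)}"
  by (cases q; cases p) auto

lemma sum_quads: "(\<Sum>q\<in>UNIV. h q) = h p + h (next_quad p) + h (next_quad (next_quad p))"
  for h :: "quad \<Rightarrow> 'a::comm_monoid_add"
proof -
  have U: "(UNIV :: quad set) = {p, next_quad p, next_quad (next_quad p)}"
    using quad_cases by blast
  have "p \<noteq> next_quad p" "p \<noteq> next_quad (next_quad p)" "next_quad p \<noteq> next_quad (next_quad p)"
    by (cases p; simp)+
  then show ?thesis by (subst U) (simp add: add.assoc)
qed

text \<open>The form depends only on the cyclic order of the types, so the preferred type can serve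
  as the base.\<close>

lemma quad_form_rotate:
  "quad_form Y W = (Y (next_quad p) - Y p) * (W (next_quad (next_quad p)) - W p) -
     (Y (next_quad (next_quad p)) - Y p) * (W (next_quad p) - W p)"
  by (cases p) (simp_all add: quad_form_def algebra_simps)

text \<open>The hypothesis says that the three values on a 3-simplex form a triangle similar to
  \<open>(0, 1, z)\<close>, so that all these triangles have the same orientation. The form of \<open>y\<close> and its
  conjugate is a constant multiple of their signed area, so that the areas add up to zero.\<close>

lemma similar_triangles_degenerate:
  fixes y :: "'t::finite \<Rightarrow> 4 set \<Rightarrow> complex"
  assumes \<Phi>: "face_pairing \<Phi>" and y: "gluing_invariant \<Phi> y" and im: "\<And>s. Im (z s) > 0"
    and sim: "\<And>s. quad_sum (y s) (next_quad (next_quad (p s))) - quad_sum (y s) (p s) =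
      z s * (quad_sum (y s) (next_quad (p s)) - quad_sum (y s) (p s))"
  shows "quad_sum (y s) q = quad_sum (y s) q'"
proof -
  define d where "d s = quad_sum (y s) (next_quad (p s)) - quad_sum (y s) (p s)" for s
  have cnj_inv: "gluing_invariant \<Phi> (\<lambda>s A. cnj (y s A))"
    using y by (simp add: gluing_invariant_def)
  have cnj_sum: "quad_sum (\<lambda>A. cnj (y s A)) q = cnj (quad_sum (y s) q)" for s q
    by (simp add: quad_sum_def)
  \<comment> \<open>With sides \<open>d s\<close> and \<open>z s * d s\<close> at the base corner,
    the form is \<open>-4 * \<i>\<close> times the signed area of the triangle.\<close>
  have form: "Im (quad_form (quad_sum (y s)) (quad_sum (\<lambda>A. cnj (y s A)))) = - 2 * (Im (z s) * (cmod (d s))\<^sup>2)" for s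
  proof -
    have "quad_form (quad_sum (y s)) (quad_sum (\<lambda>A. cnj (y s A))) = d s * cnj (z s * d s) - z s * d s * cnj (d s)"
      unfolding quad_form_rotate[where p = "p s"] cnj_sum
      by (simp only: complex_cnj_diff[symmetric] sim d_def)
    also have "\<dots> = (d s * cnj (d s)) * (cnj (z s) - z s)"
      by (simp add: algebra_simps)
    also have "Im \<dots> = - 2 * (Im (z s) * (cmod (d s))\<^sup>2)"
      unfolding complex_norm_square[symmetric] by (simp add: algebra_simps)
    finally show ?thesis .
  qed
  have "(\<Sum>s\<in>UNIV. Im (z s) * (cmod (d s))\<^sup>2) = 0"
    using arg_cong[OF sum_quad_form_zero[OF \<Phi> y cnj_inv], of Im]
    unfolding Im_sum form sum_distrib_left[symmetric] by simp
  then have "Im (z s) * (cmod (d s))\<^sup>2 = 0"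
    using im by (subst (asm) sum_nonneg_eq_0_iff) (auto simp: less_imp_le)
  then have "d s = 0" using im[of s] by auto
  then have "quad_sum (y s) (next_quad (p s)) = quad_sum (y s) (p s)"
      "quad_sum (y s) (next_quad (next_quad (p s))) = quad_sum (y s) (p s)"
    using sim[of s] by (simp_all add: d_def)
  then show ?thesis using quad_cases[of q "p s"] quad_cases[of q' "p s"] by auto
qed

text \<open>The value \<open>x0\<close> at vertex 0 is forced by the triangle 012, and the other
  values by the edges at 0. Equality of the sums over opposite edges then settles the edges 13 and
  23.\<close>

lemma vertex_potential:
  fixes y :: "4 set \<Rightarrow> complex"
  assumes "\<And>q q'. quad_sum y q = quad_sum y q'"
  obtains x where "\<And>a b. a \<noteq> b \<Longrightarrow> y {a, b} = x a + x b"
proof -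
  define x0 where "x0 = (y {0, 1} + y {0, 2} - y {1, 2}) / 2"
  define x where "x a = (if a = 0 then x0 else y {0, a} - x0)" for a
  have "quad_sum y Q01 = quad_sum y Q02" "quad_sum y Q01 = quad_sum y Q03"
    using assms by blast+
  moreover have x0: "2 * x0 = y {0, 1} + y {0, 2} - y {1, 2}"
    by (simp add: x0_def)
  ultimately have "y {1, 2} = y {0, 1} + y {0, 2} - 2 * x0" "y {1, 3} = y {0, 1} + y {0, 3} - 2 * x0"
    "y {2, 3} = y {0, 2} + y {0, 3} - 2 * x0"
    unfolding x0 by (simp_all add: quad_sum_simps algebra_simps)
  then have "\<forall>a b. a \<noteq> b \<longrightarrow> y {a, b} = x a + x b"
    unfolding forall_4_0123 by (simp add: x_def algebra_simps)
  then show thesis using that by blast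
qed

text \<open>A potential is determined by the weights on any triangle that contains the vertex, so it
  is unique and respects gluings.\<close>

lemma potential_eq:
  fixes x :: "4 \<Rightarrow> complex"
  assumes "\<And>a b. a \<noteq> b \<Longrightarrow> y {a, b} = x a + x b" "a \<noteq> b" "a \<noteq> c" "b \<noteq> c"
  shows "x a = (y {a, b} + y {a, c} - y {b, c}) / 2"
  using assms(2-4) by (simp add: assms(1))

lemma vertex_potential_glue:
  fixes x :: "'t \<Rightarrow> 4 \<Rightarrow> complex"
  assumes \<Phi>: "face_pairing \<Phi>" and y: "gluing_invariant \<Phi> y"
    and x: "\<And>s a b. a \<noteq> b \<Longrightarrow> y s {a, b} = x s a + x s b"
    and g: "\<Phi> s f = (t, \<pi>)" and "f \<noteq> a"
  shows "x t (\<pi> a) = x s a"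
proof -
  \<comment> \<open>\<open>b\<close> and \<open>c\<close> are the other vertices of the glued
    triangle, so all three weights that determine \<open>x s a\<close> are preserved.\<close>
  define b c where "b = fourth a f" and "c = fourth f a"
  have n: "a \<noteq> b" "a \<noteq> c" "b \<noteq> c" "f \<noteq> b" "f \<noteq> c"
    using fourth_neq[of a f] assms(5) by (auto simp: b_def c_def)
  note \<pi> = face_pairing_neq[OF \<Phi> g]
  have "x s a = (y s {a, b} + y s {a, c} - y s {b, c}) / 2"
    by (rule potential_eq[where x = "x s" and y = "y s", OF x]) (use n in auto)
  also have "\<dots> = (y t {\<pi> a, \<pi> b} + y t {\<pi> a, \<pi> c} - y t {\<pi> b, \<pi> c}) / 2"
    using n assms(5) by (simp add: gluing_invariantD[OF y g])
  also have "\<dots> = x t (\<pi> a)"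
    by (rule potential_eq[where x = "x t" and y = "y t", OF x, symmetric]) (use n \<pi> in auto)
  finally show ?thesis by simp
qed

lemma vertex_function:
  fixes x :: "'t \<Rightarrow> 4 \<Rightarrow> 'a"
  assumes "\<And>s f t \<pi> a. \<Phi> s f = (t, \<pi>) \<Longrightarrow> f \<noteq> a \<Longrightarrow> x t (\<pi> a) = x s a"
  obtains X where "\<And>s a. X (cell_class \<Phi> s {a}) = x s a"
proof
  \<comment> \<open>Any representative will do, since \<open>x\<close> is constant along gluings; it
    has the form \<open>(t, {b})\<close>, from which \<open>the_elem\<close> extracts
    \<open>b\<close>.\<close>
  define X where "X v = (case SOME p. p \<in> v of (s, A) \<Rightarrow> x s (the_elem A))" for v
  fix s a
  have inv: "\<exists>t b. p = (t, {b}) \<and> x t b = x s a" if "((s, {a}), p) \<in> (glued \<Phi>)\<^sup>*" for p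
    using that
  proof (induction rule: rtrancl_induct)
    case (step p q)
    obtain t b where p: "p = (t, {b})" "x t b = x s a" using step(3) by blast
    obtain f t' \<pi> where "\<Phi> t f = (t', \<pi>)" "f \<noteq> b" "q = (t', {\<pi> b})"
      using step(2) unfolding p(1) by (auto simp: glued_def)
    then show ?case using assms p(2) by auto
  qed simp
  define p where "p = (SOME p. p \<in> cell_class \<Phi> s {a})"
  have "p \<in> cell_class \<Phi> s {a}"
    unfolding p_def by (rule someI[of _ "(s, {a})"]) (simp add: cell_class_def)
  then obtain t b where "p = (t, {b})" "x t b = x s a"
    using inv[of p] by (auto simp: cell_class_def)
  then show "X (cell_class \<Phi> s {a}) = x s a" by (simp add: X_def p_def)
qed

text \<open>The derivatives of \<open>Ln z\<close>, \<open>Ln (1 / (1 - z))\<close> and \<open>Ln (1 - 1 / z)\<close>.\<close>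

definition log_deriv :: "('t::finite \<Rightarrow> quad) \<Rightarrow> complex ^ 't \<Rightarrow> 't \<Rightarrow> quad \<Rightarrow> complex" where
  "log_deriv pref w s q =
     (if q = pref s then 1 / w $ s
      else if q = next_quad (pref s) then 1 / (1 - w $ s)
      else 1 / (w $ s * (w $ s - 1)))"

text \<open>The row of the Jacobian matrix of the log-curvature map that belongs to
  \<open>e\<close>.\<close>

definition curvature_row :: "('t::finite \<Rightarrow> quad) \<Rightarrow> complex ^ 't \<Rightarrow> 't subsimplex set \<Rightarrow> complex ^ 't" where
  "curvature_row pref w e = (\<chi> s. \<Sum>q\<in>UNIV. of_nat (incidence (s, q) e) * log_deriv pref w s q)"

text \<open>Each of the two edges in \<open>q\<close> lies in exactly one edge class, so the sum
  over classes can be taken over these two edges.\<close>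

lemma sum_incidence:
  fixes y :: "'t::finite subsimplex set \<Rightarrow> 'a::comm_semiring_1"
  assumes "face_pairing \<Phi>"
  shows "(\<Sum>e\<in>edges \<Phi>. y e * of_nat (incidence (s, q) e)) = quad_sum (\<lambda>A. y (cell_class \<Phi> s A)) q"
proof -
  have fin: "finite (quad_edges q)" by simp
  have "(\<Sum>e\<in>edges \<Phi>. y e * of_nat (incidence (s, q) e)) =
      (\<Sum>e\<in>edges \<Phi>. \<Sum>A\<in>quad_edges q. if e = cell_class \<Phi> s A then y e else 0)"
  proof (rule sum.cong)
    fix e assume e: "e \<in> edges \<Phi>"
    have "(of_nat (incidence (s, q) e) :: 'a) = (\<Sum>A\<in>quad_edges q. if e = cell_class \<Phi> s A then 1 else 0)"
      by (simp add: incidence_def mem_edge_iff[OF assms e] sum.If_cases fin Int_def)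
    then show "y e * of_nat (incidence (s, q) e) = (\<Sum>A\<in>quad_edges q. if e = cell_class \<Phi> s A then y e else 0)"
      by (auto simp: sum_distrib_left intro!: sum.cong)
  qed simp
  also have "\<dots> = (\<Sum>A\<in>quad_edges q. \<Sum>e\<in>edges \<Phi>. if e = cell_class \<Phi> s A then y e else 0)"
    by (rule sum.swap)
  also have "\<dots> = (\<Sum>A\<in>quad_edges q. y (cell_class \<Phi> s A))"
  proof (rule sum.cong)
    fix A assume "A \<in> quad_edges q"
    then have "card A = 2" by (cases q) auto
    then show "(\<Sum>e\<in>edges \<Phi>. if e = cell_class \<Phi> s A then y e else 0) = y (cell_class \<Phi> s A)"
      by (simp add: cell_class_in_edges)
  qed simp
  finally show ?thesis by (simp add: quad_sum_def)
qed

lemma curvature_row_comb: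
  fixes y :: "'t::finite subsimplex set \<Rightarrow> complex"
  assumes "face_pairing \<Phi>"
  shows "(\<Sum>e\<in>edges \<Phi>. y e *s curvature_row pref w e) $ s =
    (\<Sum>q\<in>UNIV. quad_sum (\<lambda>A. y (cell_class \<Phi> s A)) q * log_deriv pref w s q)"
proof -
  have "(\<Sum>e\<in>edges \<Phi>. y e *s curvature_row pref w e) $ s =
      (\<Sum>e\<in>edges \<Phi>. \<Sum>q\<in>UNIV. y e * of_nat (incidence (s, q) e) * log_deriv pref w s q)"
    by (simp add: curvature_row_def sum_distrib_left mult.assoc)
  also have "\<dots> = (\<Sum>q\<in>UNIV. \<Sum>e\<in>edges \<Phi>. y e * of_nat (incidence (s, q) e) * log_deriv pref w s q)"
    by (rule sum.swap)
  finally show ?thesis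
    by (simp only: sum_distrib_right[symmetric] sum_incidence[OF assms])
qed

text \<open>Multiplication by \<open>z * (z - 1)\<close> turns the three derivatives into
  \<open>z - 1\<close>, \<open>- z\<close> and \<open>1\<close>, for \<open>z = w $ s\<close>. The
  condition says that the three values form a triangle similar to \<open>(0, 1, z)\<close>.\<close>

lemma log_deriv_comb_zero_iff:
  assumes "Im (w $ s) > 0"
  shows "(\<Sum>q\<in>UNIV. Y q * log_deriv pref w s q) = 0 \<longleftrightarrow>
    Y (next_quad (next_quad (pref s))) - Y (pref s) = w $ s * (Y (next_quad (pref s)) - Y (pref s))"
proof -
  have nz: "w $ s \<noteq> 0" "w $ s \<noteq> 1" using assms by auto
  have ne: "next_quad (pref s) \<noteq> pref s" "next_quad (next_quad (pref s)) \<noteq> pref s"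
    "next_quad (next_quad (pref s)) \<noteq> next_quad (pref s)"
    by (cases "pref s"; simp)+
  have "(\<Sum>q\<in>UNIV. Y q * log_deriv pref w s q) =
    (Y (next_quad (next_quad (pref s))) - Y (pref s) - w $ s * (Y (next_quad (pref s)) - Y (pref s)))
      / (w $ s * (w $ s - 1))"
    unfolding sum_quads[of _ "pref s"] using nz ne by (simp add: log_deriv_def divide_simps) (simp add: algebra_simps)
  then show ?thesis using nz by simp
qed

text \<open>The sum runs over the ends in the 3-simplex, so a loop counts its vertex twice. Vectors
  are indexed by all sets of subsimplices, hence the value 0 off the edges.\<close>

definition edge_sum :: "'t::finite gluing \<Rightarrow> complex ^ ('t subsimplex set) \<Rightarrow> complex ^ ('t subsimplex set)" where
  "edge_sum \<Phi> x = (\<chi> e. if e \<in> edges \<Phi>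
     then case SOME p. p \<in> e of (s, A) \<Rightarrow> \<Sum>a\<in>A. x $ cell_class \<Phi> s {a} else 0)"

text \<open>The sum over the ends is gluing invariant, so the representative picked by
  \<open>SOME\<close> does not matter.\<close>

lemma edge_sum_eq:
  assumes "face_pairing \<Phi>" "a \<noteq> b"
  shows "edge_sum \<Phi> x $ cell_class \<Phi> s {a, b} = x $ cell_class \<Phi> s {a} + x $ cell_class \<Phi> s {b}"
proof -
  define y where "y s A = (\<Sum>a\<in>A. x $ cell_class \<Phi> s {a})" for s A
  have "gluing_invariant \<Phi> y"
    unfolding gluing_invariant_def
  proof (intro allI impI)
    fix s f t \<pi> A assume g: "\<Phi> s f = (t, \<pi>)" "f \<notin> A"
    have "inj_on \<pi> A" using face_pairingD(1)[OF assms(1) g(1)] by (metis bij_is_inj inj_on_subset subset_UNIV)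
    then have "y t (\<pi> ` A) = (\<Sum>a\<in>A. x $ cell_class \<Phi> t (\<pi> ` {a}))"
      by (simp add: y_def sum.reindex)
    also have "\<dots> = y s A"
      unfolding y_def
    proof (rule sum.cong)
      fix a assume "a \<in> A"
      then have "f \<notin> {a}" using g(2) by blast
      then show "x $ cell_class \<Phi> t (\<pi> ` {a}) = x $ cell_class \<Phi> s {a}"
        by (simp only: cell_class_glue[OF assms(1) g(1) \<open>f \<notin> {a}\<close>])
    qed simp
    finally show "y t (\<pi> ` A) = y s A" .
  qed
  note inv = cell_class_invariant[OF assms(1) this]
  define e where "e = cell_class \<Phi> s {a, b}"
  have e: "e \<in> edges \<Phi>" using assms(2) by (auto simp: e_def intro: cell_class_in_edges)
  have "(SOME p. p \<in> e) \<in> e"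
    by (rule someI[of _ "(s, {a, b})"]) (simp add: cell_class_def e_def)
  moreover obtain t B where p: "(SOME p. p \<in> e) = (t, B)" by (cases "SOME p. p \<in> e")
  ultimately have "((s, {a, b}), (t, B)) \<in> (glued \<Phi>)\<^sup>*" by (simp add: e_def cell_class_def)
  then have "y t B = y s {a, b}" using inv[of "{a, b}"] assms(2) by simp
  then show ?thesis
    unfolding e_def[symmetric] using e p assms(2) by (simp add: edge_sum_def y_def)
qed

definition curvature_kernel :: "('t::finite \<Rightarrow> quad) \<Rightarrow> 't gluing \<Rightarrow> complex ^ 't \<Rightarrow> (complex ^ ('t subsimplex set)) set" where
  "curvature_kernel pref \<Phi> w =
     {y. (\<forall>e. e \<notin> edges \<Phi> \<longrightarrow> y $ e = 0) \<and> (\<Sum>e\<in>edges \<Phi>. y $ e *s curvature_row pref w e) = 0}"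

text \<open>The right-hand side does not involve \<open>w\<close>, so the kernel is the same at all
  points. A kernel vector gives similar triangles, which degenerate and so yield potentials that
  agree along gluings. Conversely, the two edges of each quadrilateral type cover the four vertices
  once, so the three sums agree.\<close>

lemma curvature_kernel_eq:
  assumes \<Phi>: "face_pairing \<Phi>" and w: "w \<in> upper_half_space"
  shows "curvature_kernel pref \<Phi> w = edge_sum \<Phi> ` {x. \<forall>v. v \<notin> vertices \<Phi> \<longrightarrow> x $ v = 0}"
proof (intro equalityI subsetI)
  have im: "Im (w $ s) > 0" for s using w by (simp add: upper_half_space_def)
  fix y assume y: "y \<in> curvature_kernel pref \<Phi> w"
  define Y where "Y s A = y $ cell_class \<Phi> s A" for s A
  have Y: "gluing_invariant \<Phi> Y"
    by (simp add: gluing_invariant_def Y_def cell_class_glue[OF \<Phi>])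
  have "(\<Sum>q\<in>UNIV. quad_sum (Y s) q * log_deriv pref w s q) = 0" for s
    using y curvature_row_comb[OF \<Phi>, of "\<lambda>e. y $ e" pref w s]
    by (simp add: curvature_kernel_def Y_def[abs_def])
  then have q: "quad_sum (Y s) q = quad_sum (Y s) q'" for s q q'
    by (intro similar_triangles_degenerate[OF \<Phi> Y, where z = "\<lambda>s. w $ s" and p = pref])
      (simp_all add: im log_deriv_comb_zero_iff[where w = w, OF im])
  have "\<exists>x. \<forall>a b. a \<noteq> b \<longrightarrow> Y s {a, b} = x a + x b" for s
    by (rule vertex_potential[OF q[of s]]) blast
  then obtain x where x: "\<And>s a b. a \<noteq> b \<Longrightarrow> Y s {a, b} = x s a + x s b" by metis
  obtain X where X: "\<And>s a. X (cell_class \<Phi> s {a}) = x s a"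
    using vertex_function[of \<Phi> x] vertex_potential_glue[OF \<Phi> Y x] by metis
  define X' :: "complex ^ ('a subsimplex set)" where "X' = (\<chi> v. if v \<in> vertices \<Phi> then X v else 0)"
  have X': "X' $ cell_class \<Phi> s {a} = x s a" for s a
    by (simp add: X'_def X cell_class_in_vertices)
  have "y = edge_sum \<Phi> X'"
    unfolding vec_eq_iff
  proof
    fix e
    show "y $ e = edge_sum \<Phi> X' $ e"
    proof (cases "e \<in> edges \<Phi>")
      case True
      then obtain s a b where "a \<noteq> b" "e = cell_class \<Phi> s {a, b}" by (rule edgesE)
      then show ?thesis using edge_sum_eq[OF \<Phi>] x[of a b s] X' by (simp add: Y_def)
    next
      case False
      then show ?thesis using y by (simp add: curvature_kernel_def edge_sum_def)
    qed
  qed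
  moreover have "X' \<in> {x. \<forall>v. v \<notin> vertices \<Phi> \<longrightarrow> x $ v = 0}" by (simp add: X'_def)
  ultimately show "y \<in> edge_sum \<Phi> ` {x. \<forall>v. v \<notin> vertices \<Phi> \<longrightarrow> x $ v = 0}" by blast
next
  have im: "Im (w $ s) > 0" for s using w by (simp add: upper_half_space_def)
  fix y assume "y \<in> edge_sum \<Phi> ` {x. \<forall>v. v \<notin> vertices \<Phi> \<longrightarrow> x $ v = 0}"
  then obtain x where y: "y = edge_sum \<Phi> x" by blast
  have "quad_sum (\<lambda>A. y $ cell_class \<Phi> s A) q =
      x $ cell_class \<Phi> s {0} + x $ cell_class \<Phi> s {1} + x $ cell_class \<Phi> s {2} + x $ cell_class \<Phi> s {3}" for s q
    by (cases q) (simp_all only: quad_sum_simps y edge_sum_eq[OF \<Phi>] neq_4 not_False_eq_True add_ac)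
  then have "(\<Sum>e\<in>edges \<Phi>. y $ e *s curvature_row pref w e) $ s = 0" for s
    unfolding curvature_row_comb[OF \<Phi>] log_deriv_comb_zero_iff[where w = w, OF im] by simp
  then show "y \<in> curvature_kernel pref \<Phi> w"
    unfolding curvature_kernel_def by (auto simp: y edge_sum_def vec_eq_iff simp del: sum_component)
qed

text \<open>\<open>edge_sum \<Phi>\<close> is injective on vertex weights, because the three edge
  weights on a triangle determine the values at its corners.\<close>

lemma dim_curvature_kernel:
  assumes \<Phi>: "face_pairing \<Phi>" and w: "w \<in> upper_half_space"
  shows "vec.dim (curvature_kernel pref \<Phi> w) = card (vertices \<Phi>)"
proof -
  define S where "S = {x :: complex ^ ('a subsimplex set). \<forall>v. v \<notin> vertices \<Phi> \<longrightarrow> x $ v = 0}"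
  have sub: "vec.subspace S" by (auto simp: S_def vec.subspace_def)
  have lin: "Vector_Spaces.linear (*s) (*s) (edge_sum \<Phi>)"
    by unfold_locales
      (auto simp: edge_sum_def vec_eq_iff sum.distrib sum_distrib_left split: prod.splits)
  have inj: "inj_on (edge_sum \<Phi>) S"
  proof (rule inj_onI)
    fix x x' assume S: "x \<in> S" "x' \<in> S" and eq: "edge_sum \<Phi> x = edge_sum \<Phi> x'"
    have "x $ v = x' $ v" if v: "v \<in> vertices \<Phi>" for v
    proof -
      obtain s a where v: "v = cell_class \<Phi> s {a}" by (rule verticesE[OF v])
      obtain b where ab: "a \<noteq> b" by (metis neq_4(1))
      define c where "c = fourth a b"
      have c: "a \<noteq> c" "b \<noteq> c" using fourth_neq[OF ab] by (auto simp: c_def)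
      have "x $ cell_class \<Phi> s {a} = (edge_sum \<Phi> x $ cell_class \<Phi> s {a, b} +
        edge_sum \<Phi> x $ cell_class \<Phi> s {a, c} - edge_sum \<Phi> x $ cell_class \<Phi> s {b, c}) / 2" for x
        using ab c by (simp add: edge_sum_eq[OF \<Phi>])
      then show ?thesis unfolding v using eq by metis
    qed
    moreover have "x $ v = x' $ v" if "v \<notin> vertices \<Phi>" for v
      using that S by (simp add: S_def)
    ultimately show "x = x'" unfolding vec_eq_iff by blast
  qed
  have "vec.dim (edge_sum \<Phi> ` S) = vec.dim S"
    by (rule vec.dim_image_eq[OF lin]) (simp only: vec.span_eq_iff[THEN iffD2, OF sub] inj)
  then show ?thesis
    unfolding curvature_kernel_eq[OF assms] S_def[symmetric] by (simp add: S_def dim_substandard_cart)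
qed

subsection \<open>Euler characteristics of the vertex links\<close>

text \<open>\<open>p\<close> induces a map from the classes of \<open>X\<close> to those of
  \<open>Y\<close>, and the classes are counted along its fibres.\<close>

lemma card_quotient_fibres:
  fixes r :: "('a::finite \<times> 'a) set" and r' :: "('b::finite \<times> 'b) set"
  assumes r: "equiv UNIV r" and r': "equiv UNIV r'"
    and p: "\<And>x. x \<in> X \<Longrightarrow> p x \<in> Y" "\<And>x x'. (x, x') \<in> r \<Longrightarrow> x \<in> X \<Longrightarrow> (p x, p x') \<in> r'"
  shows "card (X // r) = (\<Sum>v\<in>Y // r'. card ({x \<in> X. p x \<in> v} // r))"
proof -
  have "X // r = (\<Union>v\<in>Y // r'. {x \<in> X. p x \<in> v} // r)"
  proof (intro equalityI subsetI)
    fix c assume "c \<in> X // r"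
    then obtain x where x: "x \<in> X" "c = r `` {x}" by (rule quotientE)
    then have "x \<in> {x' \<in> X. p x' \<in> r' `` {p x}}"
      using equiv_class_self[OF r', of "p x"] by auto
    then have "c \<in> {x' \<in> X. p x' \<in> r' `` {p x}} // r"
      unfolding x(2) by (rule quotientI)
    then show "c \<in> (\<Union>v\<in>Y // r'. {x \<in> X. p x \<in> v} // r)"
      by (rule UN_I[rotated]) (rule quotientI[OF p(1)[OF x(1)]])
  qed (auto simp: quotient_def)
  moreover have "({x \<in> X. p x \<in> v} // r) \<inter> ({x \<in> X. p x \<in> w} // r) = {}"
    if v: "v \<in> Y // r'" and w: "w \<in> Y // r'" and ne: "v \<noteq> w" for v w
  proof (rule ccontr)
    assume "({x \<in> X. p x \<in> v} // r) \<inter> ({x \<in> X. p x \<in> w} // r) \<noteq> {}"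
    then obtain x y where xy: "x \<in> X" "p x \<in> v" "y \<in> X" "p y \<in> w" "r `` {x} = r `` {y}"
      by (auto simp: quotient_def)
    then have "(p x, p y) \<in> r'"
      using eq_equiv_class_iff[OF r, of x y] p(2) by simp
    moreover have "v = r' `` {p x}" "w = r' `` {p y}"
      using v w xy(2,4) r' by (auto elim!: quotientE dest!: equiv_class_eq[OF r'])
    ultimately show False using ne equiv_class_eq[OF r'] by metis
  qed
  ultimately show ?thesis by (simp add: card_UN_disjoint)
qed

section \<open>Counting the cells of all links together\<close>

lemma sym_link_glued:
  assumes "face_pairing \<Phi>"
  shows "sym (link_glued \<Phi>)"
proof (rule symI)
  fix p q assume "(p, q) \<in> link_glued \<Phi>"
  then obtain s i B f t \<pi> where g: "\<Phi> s f = (t, \<pi>)" "f \<notin> B" "i \<in> B"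
    and [simp]: "p = (s, i, B)" "q = (t, \<pi> i, \<pi> ` B)"
    by (auto simp: link_glued_def)
  note b = face_pairingD[OF assms g(1)]
  have "\<pi> f \<notin> \<pi> ` B" using g(2) b(1) by (auto simp: bij_is_inj inj_eq)
  moreover have "B = inv \<pi> ` \<pi> ` B" "i = inv \<pi> (\<pi> i)" using b(1) by (simp_all add: image_inv_f_f bij_is_inj)
  moreover have "\<pi> i \<in> \<pi> ` B" using g(3) by blast
  ultimately show "(q, p) \<in> link_glued \<Phi>"
    unfolding link_glued_def using b(4) by auto
qed

lemma equiv_link_glued: "face_pairing \<Phi> \<Longrightarrow> equiv UNIV ((link_glued \<Phi>)\<^sup>*)"
  by (intro equivI refl_rtrancl sym_rtrancl sym_link_glued trans_rtrancl) simp

definition link_cell_reps :: "nat \<Rightarrow> ('t \<times> 4 \<times> 4 set) set" where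
  "link_cell_reps k = {(s, i, B). i \<in> B \<and> card B = k + 2}"

lemma rtrancl_map:
  assumes "(x, y) \<in> r\<^sup>*" "\<And>x y. (x, y) \<in> r \<Longrightarrow> (p x, p y) \<in> r'"
  shows "(p x, p y) \<in> r'\<^sup>*"
  using assms(1) by (induction rule: rtrancl_induct) (auto intro: rtrancl_into_rtrancl assms(2))

text \<open>Link gluings carry the corner \<open>(s, {i})\<close> along, so each class of link cells
  lies over a single vertex.\<close>

lemma sum_card_link_cells:
  fixes \<Phi> :: "'t::finite gluing"
  assumes \<Phi>: "face_pairing \<Phi>"
  shows "(\<Sum>v\<in>vertices \<Phi>. card (link_cells \<Phi> v k)) = card (link_cell_reps k // (link_glued \<Phi>)\<^sup>*)"
proof -
  define p :: "'t \<times> 4 \<times> 4 set \<Rightarrow> 't subsimplex" where "p = (\<lambda>(s, i, B). (s, {i}))"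
  have "card (link_cell_reps k // (link_glued \<Phi>)\<^sup>*) =
      (\<Sum>v\<in>vertices \<Phi>. card ({x \<in> link_cell_reps k. p x \<in> v} // (link_glued \<Phi>)\<^sup>*))"
    unfolding vertices_def
  proof (rule card_quotient_fibres[OF equiv_link_glued[OF \<Phi>] equiv_glued[OF \<Phi>]])
    show "(p x, p y) \<in> (glued \<Phi>)\<^sup>*" if "(x, y) \<in> (link_glued \<Phi>)\<^sup>*" for x y
      using that
    proof (rule rtrancl_map)
      fix x y assume "(x, y) \<in> link_glued \<Phi>"
      then obtain s i B f t \<pi> where "\<Phi> s f = (t, \<pi>)" "i \<in> B" "f \<notin> B" "x = (s, i, B)" "y = (t, \<pi> i, \<pi> ` B)"
        unfolding link_glued_def by blast
      then have "p x = (s, {i})" "p y = (t, \<pi> ` {i})" "f \<notin> {i}" "\<Phi> s f = (t, \<pi>)"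
        by (auto simp: p_def)
      then show "(p x, p y) \<in> glued \<Phi>" unfolding glued_def by blast
    qed
  qed (auto simp: p_def)
  moreover have "{x \<in> link_cell_reps k. p x \<in> v} = {(s, i, B). (s, {i}) \<in> v \<and> i \<in> B \<and> card B = k + 2}" for v
    by (auto simp: link_cell_reps_def p_def)
  ultimately show ?thesis by (simp add: link_cells_def)
qed

text \<open>A gluing only moves cells that miss the vertex opposite to its triangle, so link
  triangles stay apart: one for each corner of a 3-simplex.\<close>

lemma card_link_triangles:
  "card (link_cell_reps 2 // (link_glued (\<Phi> :: 't::finite gluing))\<^sup>*) = 4 * CARD('t)"
proof -
  have B: "card B = 4 \<longleftrightarrow> B = UNIV" for B :: "4 set"
    using card_eq_UNIV_imp_eq_UNIV[of B] by auto
  have "(link_glued \<Phi>)\<^sup>* `` {x} = {x}" if x: "x \<in> link_cell_reps 2" for x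
  proof -
    have "(x, y) \<notin> link_glued \<Phi>" for y
      using x by (auto simp: link_cell_reps_def link_glued_def B)
    then show ?thesis by (auto elim: converse_rtranclE)
  qed
  then have "link_cell_reps 2 // (link_glued \<Phi>)\<^sup>* = (\<lambda>x. {x}) ` (link_cell_reps 2 :: ('t \<times> 4 \<times> 4 set) set)"
    by (auto simp: quotient_def)
  moreover have "(link_cell_reps 2 :: ('t \<times> 4 \<times> 4 set) set) = (\<lambda>(s, i). (s, i, UNIV)) ` UNIV"
    by (auto simp: link_cell_reps_def B image_iff)
  moreover have "inj (\<lambda>(s :: 't, i :: 4). (s, i, UNIV :: 4 set))"
    by (auto simp: inj_def)
  ultimately show ?thesis
    by (simp add: card_image card_prod)
qed

text \<open>A 3-simplex has 12 link sides, one for each corner \<open>i\<close> of each triangle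
  opposite to some \<open>f\<close>. The involution \<open>M\<close> has no fixed point and matches
  the sides in pairs.\<close>

lemma card_link_edges:
  assumes \<Phi>: "face_pairing (\<Phi> :: 't::finite gluing)"
  shows "card (link_cell_reps 1 // (link_glued \<Phi>)\<^sup>*) = 6 * CARD('t)"
proof -
  define c :: "'t \<times> 4 \<times> 4 \<Rightarrow> 't \<times> 4 \<times> 4 set" where "c = (\<lambda>(s, i, f). (s, i, - {f}))"
  define M where "M = (\<lambda>(s, i, f). let (t, \<pi>) = \<Phi> s f in (t, \<pi> i, \<pi> f))"
  have inj: "inj c" by (auto simp: inj_def c_def)
  have reps: "link_cell_reps 1 = c ` directed_edges"
  proof -
    have compl: "\<exists>f. B = - {f}" if "card B = 3" for B :: "4 set"
    proof -
      have "card (- B) = 1" using that by (simp add: Compl_eq_Diff_UNIV card_Diff_subset)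
      then show ?thesis by (metis card_1_singletonE double_complement)
    qed
    have card: "card (- {f}) = 3" for f :: 4 by (simp add: Compl_eq_Diff_UNIV card_Diff_subset)
    show ?thesis
    proof (intro equalityI subsetI)
      fix x :: "'t \<times> 4 \<times> 4 set" assume "x \<in> link_cell_reps 1"
      then obtain s i B where x: "x = (s, i, B)" "i \<in> B" "card B = 3" by (auto simp: link_cell_reps_def)
      obtain f where f: "B = - {f}" using compl[OF x(3)] by blast
      then have "x = c (s, i, f)" "(s, i, f) \<in> directed_edges"
        using x(1,2) by (auto simp: c_def directed_edges_def)
      then show "x \<in> c ` directed_edges" by (rule image_eqI)
    next
      fix x assume "x \<in> c ` directed_edges"
      then show "x \<in> link_cell_reps 1" by (auto simp: c_def directed_edges_def link_cell_reps_def card)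
    qed
  qed
  have M: "M (M x) = x" "M x \<noteq> x" "x \<in> directed_edges \<Longrightarrow> M x \<in> directed_edges" for x
  proof -
    obtain s i f where x: "x = (s, i, f)" by (cases x)
    obtain t \<pi> where g: "\<Phi> s f = (t, \<pi>)" by (cases "\<Phi> s f")
    note p = face_pairingD[OF \<Phi> g]
    show "M (M x) = x" "M x \<noteq> x" "x \<in> directed_edges \<Longrightarrow> M x \<in> directed_edges"
      using p g face_pairing_neq[OF \<Phi> g] by (auto simp: M_def x bij_is_inj directed_edges_def)
  qed
  have glue: "(c x, y) \<in> link_glued \<Phi> \<longleftrightarrow> y = c (M x)" if "x \<in> directed_edges" for x y
  proof -
    obtain s i f where x: "x = (s, i, f)" by (cases x)
    obtain t \<pi> where g: "\<Phi> s f = (t, \<pi>)" by (cases "\<Phi> s f")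
    have "\<pi> ` (- {f}) = - {\<pi> f}"
      using face_pairingD(1)[OF \<Phi> g] by (simp add: bij_image_Compl_eq)
    then show ?thesis
      using that g by (auto simp: link_glued_def c_def M_def x directed_edges_def)
  qed
  have cls: "(link_glued \<Phi>)\<^sup>* `` {c x} = {c x, c (M x)}" if x: "x \<in> directed_edges" for x
  proof (intro equalityI subsetI)
    fix y assume "y \<in> (link_glued \<Phi>)\<^sup>* `` {c x}"
    then have "(c x, y) \<in> (link_glued \<Phi>)\<^sup>*" by simp
    then show "y \<in> {c x, c (M x)}"
    proof (induction rule: rtrancl_induct)
      case (step y z)
      then show ?case using glue[OF x, of z] glue[OF M(3)[OF x], of z] M(1)[of x] by auto
    qed simp
  next
    fix y assume "y \<in> {c x, c (M x)}"
    then show "y \<in> (link_glued \<Phi>)\<^sup>* `` {c x}" using glue[OF x, of "c (M x)"] by auto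
  qed
  let ?Q = "link_cell_reps 1 // (link_glued \<Phi>)\<^sup>*"
  have Q: "?Q = (\<lambda>x. {c x, c (M x)}) ` directed_edges"
    unfolding reps quotient_def using cls by auto
  have "2 * card ?Q = card (\<Union> ?Q)"
  proof (rule card_partition)
    show "card X = 2" if "X \<in> ?Q" for X
    proof -
      obtain x where "X = {c x, c (M x)}" using \<open>X \<in> ?Q\<close> unfolding Q by blast
      moreover have "c x \<noteq> c (M x)" using M(2)[of x] inj_eq[OF inj, of x "M x"] by metis
      ultimately show ?thesis by simp
    qed
    show "X \<inter> Y = {}" if "X \<in> ?Q" "Y \<in> ?Q" "X \<noteq> Y" for X Y
      using quotient_disj[OF equiv_link_glued[OF \<Phi>], of X Y] that by (auto simp: quotient_def)
  qed simp_all
  also have "\<Union> ?Q = c ` directed_edges" unfolding Q using M(3) by auto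
  also have "card \<dots> = card (directed_edges :: ('t \<times> 4 \<times> 4) set)"
    by (rule card_image) (use inj in \<open>auto intro: inj_on_subset\<close>)
  also have "(directed_edges :: ('t \<times> 4 \<times> 4) set) = UNIV \<times> {(a, b). a \<noteq> b}"
    by (auto simp: directed_edges_def)
  also have "card \<dots> = CARD('t) * 12"
    using sum_pairs_4[of "\<lambda>a b. 1 :: nat"] by (simp add: card_cartesian_product case_prod_unfold)
  finally show ?thesis by simp
qed

text \<open>Gluings of faces move their vertices along, so every vertex of a later representative
  comes from a vertex of \<open>A\<close>.\<close>

lemma link_glued_lift:
  assumes "((s, A), q) \<in> (glued \<Phi>)\<^sup>*" "i \<in> snd q"
  shows "\<exists>j\<in>A. ((s, j, A), (fst q, i, snd q)) \<in> (link_glued \<Phi>)\<^sup>*"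
  using assms
proof (induction arbitrary: i rule: rtrancl_induct)
  case (step p q)
  obtain t B f t' \<pi> where g: "\<Phi> t f = (t', \<pi>)" "f \<notin> B" and [simp]: "p = (t, B)" "q = (t', \<pi> ` B)"
    using step(2) by (auto simp: glued_def)
  obtain k where k: "k \<in> B" "i = \<pi> k" using step(4) by auto
  obtain j where "j \<in> A" "((s, j, A), (t, k, B)) \<in> (link_glued \<Phi>)\<^sup>*"
    using step(3)[of k] k by auto
  moreover have "((t, k, B), (t', i, \<pi> ` B)) \<in> link_glued \<Phi>"
    using g k by (auto simp: link_glued_def)
  ultimately show ?case by (auto intro: rtrancl_into_rtrancl)
qed auto

text \<open>By lifting, all link vertices over an edge come from the two ends of one representative,
  and these are distinct by \<open>link_no_reverse\<close>.\<close>

lemma card_link_vertices: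
  assumes \<Phi>: "face_pairing (\<Phi> :: 't::finite gluing)"
  shows "card (link_cell_reps 0 // (link_glued \<Phi>)\<^sup>*) = 2 * card (edges \<Phi>)"
proof -
  define p :: "'t \<times> 4 \<times> 4 set \<Rightarrow> 't subsimplex" where "p = (\<lambda>(s, i, B). (s, B))"
  let ?L = "(link_glued \<Phi>)\<^sup>*"
  have "card (link_cell_reps 0 // ?L) = (\<Sum>e\<in>edges \<Phi>. card ({x \<in> link_cell_reps 0. p x \<in> e} // ?L))"
    unfolding edges_def
  proof (rule card_quotient_fibres[OF equiv_link_glued[OF \<Phi>] equiv_glued[OF \<Phi>]])
    show "(p x, p y) \<in> (glued \<Phi>)\<^sup>*" if "(x, y) \<in> ?L" for x y
      using that
    proof (rule rtrancl_map)
      fix x y assume "(x, y) \<in> link_glued \<Phi>"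
      then obtain s i B f t \<pi> where "\<Phi> s f = (t, \<pi>)" "f \<notin> B" "x = (s, i, B)" "y = (t, \<pi> i, \<pi> ` B)"
        unfolding link_glued_def by blast
      then have "p x = (s, B)" "p y = (t, \<pi> ` B)" "f \<notin> B" "\<Phi> s f = (t, \<pi>)"
        by (auto simp: p_def)
      then show "(p x, p y) \<in> glued \<Phi>" unfolding glued_def by blast
    qed
  qed (auto simp: p_def link_cell_reps_def)
  also have "\<dots> = (\<Sum>e\<in>edges \<Phi>. 2)"
  proof (rule sum.cong)
    fix e assume "e \<in> edges \<Phi>"
    then obtain s a b where ab: "a \<noteq> b" and e: "e = cell_class \<Phi> s {a, b}" by (rule edgesE)
    have "{x \<in> link_cell_reps 0. p x \<in> e} // ?L = {?L `` {(s, a, {a, b})}, ?L `` {(s, b, {a, b})}}" (is "?l = ?r")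
    proof (intro equalityI subsetI)
      fix C assume "C \<in> ?l"
      then obtain t i B where x: "(t, i, B) \<in> link_cell_reps 0" "(t, B) \<in> e" "C = ?L `` {(t, i, B)}"
        by (auto simp: p_def elim!: quotientE)
      then obtain j where j: "j \<in> {a, b}" "((s, j, {a, b}), (t, i, B)) \<in> ?L"
        using link_glued_lift[of s "{a, b}" "(t, B)" \<Phi> i] by (auto simp: e cell_class_def link_cell_reps_def)
      have "C = ?L `` {(s, j, {a, b})}"
        unfolding x(3) by (rule equiv_class_eq[OF equiv_link_glued[OF \<Phi>] j(2), symmetric])
      then show "C \<in> ?r" using j(1) by blast
    next
      fix C assume "C \<in> ?r"
      then obtain i where "i \<in> {a, b}" "C = ?L `` {(s, i, {a, b})}" by auto
      moreover have "(s, i, {a, b}) \<in> {x \<in> link_cell_reps 0. p x \<in> e}"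
        using calculation(1) ab by (auto simp: e p_def link_cell_reps_def cell_class_def)
      ultimately show "C \<in> ?l" by (auto intro: quotientI)
    qed
    moreover have "?L `` {(s, a, {a, b})} \<noteq> ?L `` {(s, b, {a, b})}"
      using link_no_reverse[OF \<Phi> ab] eq_equiv_class_iff[OF equiv_link_glued[OF \<Phi>]] by simp
    ultimately show "card ?l = 2" by simp
  qed simp
  finally show ?thesis by simp
qed

text \<open>The Euler characteristics add up to \<open>2 E - 6 T + 4 T\<close>, and each genus is
  \<open>1 - \<chi> / 2\<close>.\<close>

lemma sum_link_genus:
  assumes \<Phi>: "face_pairing (\<Phi> :: 't::finite gluing)"
  shows "(\<Sum>v\<in>vertices \<Phi>. link_genus \<Phi> v) =
    of_nat (card (vertices \<Phi>)) - of_nat (card (edges \<Phi>)) + of_nat CARD('t)"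
proof -
  have "(\<Sum>v\<in>vertices \<Phi>. link_euler_char \<Phi> v) =
      (\<Sum>k\<le>2. (-1) ^ k * int (card (link_cell_reps k // (link_glued \<Phi>)\<^sup>*)))"
    unfolding link_euler_char_def sum_card_link_cells[OF \<Phi>, symmetric] of_nat_sum sum_distrib_left
    by (rule sum.swap)
  also have "\<dots> = 2 * int (card (edges \<Phi>)) - 2 * int CARD('t)"
    using card_link_vertices[OF \<Phi>] card_link_edges[OF \<Phi>] card_link_triangles[of \<Phi>]
    by (simp add: numeral_2_eq_2)
  finally have "(\<Sum>v\<in>vertices \<Phi>. of_int (link_euler_char \<Phi> v) :: rat) =
      2 * of_nat (card (edges \<Phi>)) - 2 * of_nat CARD('t)"
    by (simp flip: of_int_sum)
  then show ?thesis
    by (simp add: link_genus_def sum_divide_distrib[symmetric] sum_subtractf diff_divide_distrib)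
qed

subsection \<open>The derivative of the log-curvature map\<close>

definition log_shape :: "('t::finite \<Rightarrow> quad) \<Rightarrow> complex ^ 't \<Rightarrow> 't \<Rightarrow> quad \<Rightarrow> complex" where
  "log_shape pref w s q =
     (if q = pref s then Ln (w $ s)
      else if q = next_quad (pref s) then Ln (1 / (1 - w $ s))
      else Ln (1 - 1 / w $ s))"

text \<open>The inverse of \<open>shape_coords\<close> is made explicit: the shapes are
  \<open>z\<close>, \<open>1 / (1 - z)\<close> and \<open>1 - 1 / z\<close> in cyclic order from the
  preferred type.\<close>

lemma log_curvature_eq:
  assumes "w \<in> upper_half_space"
  shows "log_curvature pref w e = (\<Sum>s\<in>UNIV. \<Sum>q\<in>UNIV. of_nat (incidence (s, q) e) * log_shape pref w s q)"
proof -
  define z where "z = the_inv_into shapes (shape_coords pref) w"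
  note b = bij_betw_shape_coords[of pref]
  have z: "z \<in> shapes" "shape_coords pref z = w"
    using the_inv_into_into[OF bij_betw_imp_inj_on[OF b], of w] f_the_inv_into_f_bij_betw[OF b, of w]
      bij_betw_imp_surj_on[OF b] assms by (auto simp: z_def)
  have nz: "w $ s \<noteq> 0" "w $ s \<noteq> 1" for s
    using assms by (auto simp: upper_half_space_def dest!: spec[of _ s])
  have nxt: "z (s, next_quad q) = 1 / (1 - z (s, q))" for s q
    using z(1) by (simp add: shapes_def)
  have z0: "z (s, pref s) = w $ s" for s
    using z(2) by (auto simp: shape_coords_def)
  have "z (s, next_quad (next_quad (pref s))) = 1 - 1 / w $ s" for s
    using nz[of s] by (simp add: nxt z0 divide_simps)
  then have "Ln (z (s, q)) = log_shape pref w s q" for s q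
    using quad_cases[of q "pref s"] z0[of s] nxt[of s "pref s"] by (auto simp: log_shape_def)
  then have "(\<Sum>x\<in>UNIV. of_nat (incidence x e) * Ln (z x)) =
      (\<Sum>(s, q)\<in>UNIV \<times> UNIV. of_nat (incidence (s, q) e) * log_shape pref w s q)"
    by (intro sum.cong) auto
  then show ?thesis
    unfolding sum.cartesian_product by (simp add: log_curvature_def z_def)
qed

lemma Im_pos_transforms:
  assumes "Im z > 0"
  shows "Im (1 / (1 - z)) > 0" "Im (1 - 1 / z) > 0"
  using assms by (auto simp: Im_divide complex_eq_iff intro!: divide_pos_pos sum_power2_gt_zero_iff[THEN iffD2])

lemma not_nonpos_Reals_of_Im: "Im z > 0 \<Longrightarrow> z \<notin> \<real>\<^sub>\<le>\<^sub>0"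
  by (auto simp: complex_nonpos_Reals_iff)

lemma log_shape_has_derivative:
  assumes "w \<in> upper_half_space"
  shows "((\<lambda>w. log_shape pref w s q) has_derivative (\<lambda>v. log_deriv pref w s q * v $ s)) (at w)"
proof -
  have im: "Im (w $ s) > 0" using assms by (simp add: upper_half_space_def)
  then have nz: "w $ s \<noteq> 0" "1 - w $ s \<noteq> 0" "w $ s - 1 \<noteq> 0" by (auto simp: complex_eq_iff)
  have comp: "((\<lambda>w. f (w $ s)) has_derivative (\<lambda>v. D * v $ s)) (at w)"
    if "(f has_field_derivative D) (at (w $ s))" for f D
    using has_derivative_compose[OF bounded_linear_imp_has_derivative[OF bounded_linear_vec_nth]
        that[unfolded has_field_derivative_def]] .
  have 1: "(Ln has_field_derivative 1 / w $ s) (at (w $ s))"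
    using has_field_derivative_Ln[OF not_nonpos_Reals_of_Im[OF im]] by (simp add: inverse_eq_divide)
  have 2: "((\<lambda>z. Ln (1 / (1 - z))) has_field_derivative 1 / (1 - w $ s)) (at (w $ s))"
  proof -
    have "((\<lambda>z. 1 / (1 - z)) has_field_derivative 1 / (1 - w $ s)\<^sup>2) (at (w $ s))"
      using nz by (auto intro!: derivative_eq_intros simp: power2_eq_square)
    note DERIV_chain2[where f = Ln and g = "\<lambda>z. 1 / (1 - z)",
        OF has_field_derivative_Ln[OF not_nonpos_Reals_of_Im[OF Im_pos_transforms(1)[OF im]]] this]
    moreover have "inverse (1 / a) * (1 / a\<^sup>2) = 1 / a" if "a \<noteq> 0" for a :: complex
      using that by (simp add: power2_eq_square)
    ultimately show ?thesis using nz(2) by (metis DERIV_cong)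
  qed
  have 3: "((\<lambda>z. Ln (1 - 1 / z)) has_field_derivative 1 / (w $ s * (w $ s - 1))) (at (w $ s))"
  proof -
    have "((\<lambda>z. 1 - 1 / z) has_field_derivative 1 / (w $ s)\<^sup>2) (at (w $ s))"
      using nz by (auto intro!: derivative_eq_intros simp: power2_eq_square)
    from DERIV_chain2[where f = Ln and g = "\<lambda>z. 1 - 1 / z",
        OF has_field_derivative_Ln[OF not_nonpos_Reals_of_Im[OF Im_pos_transforms(2)[OF im]]] this]
    show ?thesis by (rule DERIV_cong) (use nz in \<open>simp add: power2_eq_square divide_simps\<close>)
  qed
  show ?thesis
    using comp[OF 1] comp[OF 2] comp[OF 3] by (simp add: log_shape_def log_deriv_def)
qed

lemma upper_half_space_eq: "(upper_half_space :: (complex ^ 't) set) = (\<Inter>s. (\<lambda>w. Im (w $ s)) -` {0<..})"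
  by (auto simp: upper_half_space_def)

lemma open_upper_half_space: "open (upper_half_space :: (complex ^ 't::finite) set)"
  unfolding upper_half_space_eq by (intro open_INT finite ballI open_vimage continuous_intros open_greaterThan)

text \<open>On a convex domain a vanishing derivative implies constancy;
  \<open>curvature_relation_constant\<close> relies on this.\<close>

lemma convex_upper_half_space: "convex (upper_half_space :: (complex ^ 't::finite) set)"
  unfolding upper_half_space_eq
proof (intro convex_INT)
  fix s :: 't
  have "linear (\<lambda>w :: complex ^ 't. Im (w $ s))" by (intro linearI) auto
  then show "convex ((\<lambda>w :: complex ^ 't. Im (w $ s)) -` {0<..})"
    by (rule convex_linear_vimage) simp
qed

lemma log_curvature_has_derivative:
  assumes w: "w \<in> upper_half_space"
  shows "((\<lambda>w. log_curvature pref w e) has_derivative dot (curvature_row pref w e)) (at w)"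
proof -
  have "((\<lambda>w. \<Sum>s\<in>UNIV. \<Sum>q\<in>UNIV. of_nat (incidence (s, q) e) * log_shape pref w s q) has_derivative
      (\<lambda>v. \<Sum>s\<in>UNIV. \<Sum>q\<in>UNIV. of_nat (incidence (s, q) e) * (log_deriv pref w s q * v $ s))) (at w)"
    by (intro has_derivative_sum has_derivative_mult_right log_shape_has_derivative w)
  then have "((\<lambda>w. \<Sum>s\<in>UNIV. \<Sum>q\<in>UNIV. of_nat (incidence (s, q) e) * log_shape pref w s q) has_derivative
      dot (curvature_row pref w e)) (at w)"
    by (simp add: dot_def[abs_def] curvature_row_def sum_distrib_right mult.assoc)
  then show ?thesis
    by (rule has_derivative_transform_within_open[OF _ open_upper_half_space w]) (simp add: log_curvature_eq)
qed

lemma continuous_on_curvature_row: "continuous_on upper_half_space (\<lambda>w. curvature_row pref w e)"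
proof -
  have nz: "w $ s \<noteq> 0" "w $ s \<noteq> 1" if "w \<in> upper_half_space" for w and s :: 'a
    using that by (auto simp: upper_half_space_def dest!: spec[of _ s])
  have "continuous_on upper_half_space (\<lambda>w. log_deriv pref w s q)" for s q
    unfolding log_deriv_def
    by (cases "q = pref s"; cases "q = next_quad (pref s)") (auto intro!: continuous_intros simp: nz)
  then show ?thesis
    unfolding curvature_row_def by (intro continuous_on_vec_lambda continuous_intros)
qed

text \<open>As the kernel does not depend on the point, \<open>y\<close> annihilates the derivative
  everywhere, so this combination of the components has zero derivative on a convex set.\<close>

lemma curvature_relation_constant:
  fixes y :: "complex ^ ('t::finite subsimplex set)"
  assumes \<Phi>: "face_pairing \<Phi>" and w: "w \<in> upper_half_space" "w' \<in> upper_half_space"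
    and y: "y \<in> curvature_kernel pref \<Phi> w"
  shows "(\<Sum>e\<in>edges \<Phi>. y $ e * log_curvature pref w' e) = (\<Sum>e\<in>edges \<Phi>. y $ e * log_curvature pref w e)"
proof -
  have "((\<lambda>w. \<Sum>e\<in>edges \<Phi>. y $ e * log_curvature pref w e) has_derivative (\<lambda>v. 0)) (at x within upper_half_space)"
    if x: "x \<in> upper_half_space" for x
  proof -
    have "y \<in> curvature_kernel pref \<Phi> x"
      using y by (simp only: curvature_kernel_eq[OF \<Phi> x] curvature_kernel_eq[OF \<Phi> w(1)])
    then have zero: "(\<Sum>e\<in>edges \<Phi>. y $ e *s curvature_row pref x e) = 0"
      by (simp add: curvature_kernel_def)
    have "(\<Sum>e\<in>edges \<Phi>. y $ e * dot (curvature_row pref x e) v) = 0" for v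
    proof -
      have "(\<Sum>e\<in>edges \<Phi>. y $ e * dot (curvature_row pref x e) v) =
          (\<Sum>e\<in>edges \<Phi>. \<Sum>s\<in>UNIV. (y $ e *s curvature_row pref x e) $ s * v $ s)"
        by (simp add: dot_def sum_distrib_left mult.assoc)
      also have "\<dots> = (\<Sum>s\<in>UNIV. (\<Sum>e\<in>edges \<Phi>. y $ e *s curvature_row pref x e) $ s * v $ s)"
        unfolding sum_component sum_distrib_right by (rule sum.swap)
      finally show ?thesis by (simp add: zero)
    qed
    moreover have "((\<lambda>w. \<Sum>e\<in>edges \<Phi>. y $ e * log_curvature pref w e) has_derivative
        (\<lambda>v. \<Sum>e\<in>edges \<Phi>. y $ e * dot (curvature_row pref x e) v)) (at x within upper_half_space)"
      by (intro has_derivative_sum has_derivative_mult_right has_derivative_at_withinI[OF log_curvature_has_derivative] x)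
    ultimately show ?thesis by simp
  qed
  from has_derivative_zero_constant[OF convex_upper_half_space this] w show ?thesis by metis
qed

section \<open>Charts of the fibre and the dimension count\<close>

theorem corollary3:
  fixes \<Phi> :: "'t::finite gluing"
    and pref :: "'t \<Rightarrow> quad"
    and u :: "'t subsimplex set \<Rightarrow> complex"
  assumes "oriented_triangulation \<Phi>"
  shows "log_curvature_fibre \<Phi> pref u = {} \<or>
    (\<exists>d. of_nat d = (\<Sum>v\<in>vertices \<Phi>. link_genus \<Phi> v) \<and>
         complex_submanifold d (log_curvature_fibre \<Phi> pref u))"
proof (intro disjCI)
  let ?M = "log_curvature_fibre \<Phi> pref u"
  have \<Phi>: "face_pairing \<Phi>" using assms by (simp add: oriented_triangulation_def)
  \<comment> \<open>The subtraction is truncated, so \<open>chart\<close> also proves the additive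
    form of this equation, from the rank at a point of the fibre.\<close>
  define d where "d = CARD('t) + card (vertices \<Phi>) - card (edges \<Phi>)"
  have chart: "card (edges \<Phi>) + d = CARD('t) + card (vertices \<Phi>) \<and>
      (\<exists>U (W :: (complex ^ 't) set) \<phi> \<psi> S.
        open U \<and> x \<in> U \<and> open W \<and>
        holomorphic_map_on \<phi> U \<and> holomorphic_map_on \<psi> W \<and>
        \<phi> ` U = W \<and> \<psi> ` W = U \<and> (\<forall>y\<in>U. \<psi> (\<phi> y) = y) \<and> (\<forall>w\<in>W. \<phi> (\<psi> w) = w) \<and>
        card S = d \<and> \<phi> ` (?M \<inter> U) = {w \<in> W. \<forall>i. i \<notin> S \<longrightarrow> w $ i = 0})"
    if x: "x \<in> ?M" for x
  proof -
    have xH: "x \<in> upper_half_space" using x by (simp add: log_curvature_fibre_def)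
    obtain J where J: "J \<subseteq> edges \<Phi>" "inj_on (curvature_row pref x) J"
      "vec.independent (curvature_row pref x ` J)"
      "card J + vec.dim (curvature_kernel pref \<Phi> x) = card (edges \<Phi>)"
      "\<And>e. e \<in> edges \<Phi> \<Longrightarrow> \<exists>c. axis e 1 - (\<Sum>j\<in>J. c j *s axis j 1) \<in> curvature_kernel pref \<Phi> x"
      using row_basis[of "edges \<Phi>" "curvature_row pref x"] unfolding curvature_kernel_def by blast
    \<comment> \<open>The equations in \<open>J\<close> imply all the others: each further component
      is a fixed combination of those in \<open>J\<close> plus a constant, and the point
      \<open>x\<close> of the fibre shows that this constant is the right one.\<close>
    have M: "?M = {w \<in> upper_half_space. \<forall>e\<in>J. log_curvature pref w e = u e}"
    proof (intro equalityI subsetI)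
      fix w assume w: "w \<in> {w \<in> upper_half_space. \<forall>e\<in>J. log_curvature pref w e = u e}"
      have "log_curvature pref w e = u e" if e: "e \<in> edges \<Phi>" for e
      proof -
        obtain c where c: "axis e 1 - (\<Sum>j\<in>J. c j *s axis j 1) \<in> curvature_kernel pref \<Phi> x"
          using J(5)[OF e] by blast
        have comb: "(\<Sum>e'\<in>edges \<Phi>. (axis e 1 - (\<Sum>j\<in>J. c j *s axis j 1)) $ e' * h e') =
            h e - (\<Sum>j\<in>J. c j * h j)" for h
        proof -
          have "(\<Sum>e'\<in>edges \<Phi>. axis e 1 $ e' * h e') = (\<Sum>e'\<in>edges \<Phi>. if e' = e then h e' else 0)"
            by (rule sum.cong) (auto simp: axis_def)
          moreover have "(\<Sum>e'\<in>edges \<Phi>. (if e' \<in> J then c e' else 0) * h e') = (\<Sum>j\<in>J. c j * h j)"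
            by (rule sum.mono_neutral_cong_right) (use J(1) in auto)
          ultimately show ?thesis
            unfolding vector_minus_component vec_nth_sum_axis left_diff_distrib sum_subtractf
            using e by simp
        qed
        have "log_curvature pref w e - (\<Sum>j\<in>J. c j * log_curvature pref w j) =
            log_curvature pref x e - (\<Sum>j\<in>J. c j * log_curvature pref x j)"
          using curvature_relation_constant[OF \<Phi> xH _ c, of w] w unfolding comb by simp
        moreover have "(\<Sum>j\<in>J. c j * log_curvature pref w j) = (\<Sum>j\<in>J. c j * log_curvature pref x j)"
          using w x J(1) by (intro sum.cong) (auto simp: log_curvature_fibre_def)
        ultimately show ?thesis using x e by (simp add: log_curvature_fibre_def)
      qed
      then show "w \<in> ?M" using w by (simp add: log_curvature_fibre_def)
    qed (use J(1) in \<open>auto simp: log_curvature_fibre_def\<close>)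
    obtain U W \<phi> \<psi> and S :: "'t set" where ch:
      "open U" "x \<in> U" "open W" "holomorphic_map_on \<phi> U" "holomorphic_map_on \<psi> W"
      "\<phi> ` U = W" "\<psi> ` W = U" "\<And>y. y \<in> U \<Longrightarrow> \<psi> (\<phi> y) = y" "\<And>w. w \<in> W \<Longrightarrow> \<phi> (\<psi> w) = w"
      "card S + card J = CARD('t)"
      "\<phi> ` (?M \<inter> U) = {w \<in> W. \<forall>i. i \<notin> S \<longrightarrow> w $ i = 0}"
    proof (rule regular_level_set_chart[OF open_upper_half_space xH, where J = J and c = u
          and F = "\<lambda>e w. log_curvature pref w e" and D = "\<lambda>e w. curvature_row pref w e"], goal_cases)
      case 1 show ?case using 1(3) by (rule log_curvature_has_derivative)
    next
      case 2 show ?case by (rule continuous_on_curvature_row)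
    next
      case 3 show ?case using J(2) by simp
    next
      case 4 show ?case using J(3) by simp
    next
      case (5 U W \<phi> \<psi> S)
      then show ?case unfolding M by blast
    qed
    have cnt: "card S + card (edges \<Phi>) = CARD('t) + card (vertices \<Phi>)"
      using J(4) ch(10) dim_curvature_kernel[OF \<Phi> xH, of pref] by simp
    then have "card S = d" by (simp add: d_def)
    with ch cnt show ?thesis by (intro conjI exI[of _ U] exI[of _ W] exI[of _ \<phi>] exI[of _ \<psi>] exI[of _ S]) auto
  qed
  assume "\<not> (\<exists>d. of_nat d = (\<Sum>v\<in>vertices \<Phi>. link_genus \<Phi> v) \<and> complex_submanifold d ?M)"
  moreover have "complex_submanifold d ?M"
    unfolding complex_submanifold_def using chart by blast
  moreover have "of_nat d = (\<Sum>v\<in>vertices \<Phi>. link_genus \<Phi> v)" if "x \<in> ?M" for x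
  proof -
    have "(of_nat (card (edges \<Phi>) + d) :: rat) = of_nat (CARD('t) + card (vertices \<Phi>))"
      using chart[OF that] by simp
    then show ?thesis unfolding sum_link_genus[OF \<Phi>] by simp
  qed
  ultimately show "?M = {}" by blast
qed

end
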